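(* Let $\tau$ be an arithmetic signature. Then for every $\tau$-formula $\phi$ in negation normal form there is a $\tau$-formula $\phi'$ such that (1) $\phi'$ is equivalent to $\phi$ on finite structures (i.e. on all structures in $\mathrm{STRUC}[\tau]$ and all assignments to the free variables), (2) $\mathrm{qr}(\phi') = 3\cdot \mathrm{strong\text{-}qr}(\phi) + O(\mathrm{arity}(\tau))$, and (3) $|\mathrm{bound}(\phi')| = |\mathrm{strong\text{-}bound}(\phi)| + O(\mathrm{arity}(\tau))$.
   Context: A signature $\tau$ is arithmetic if it contains $<$, ternary $\mathrm{add}$, ternary $\mathrm{mult}$, unary function $\mathrm{succ}$ and constant $0$; $\mathrm{STRUC}[\tau]$ contains only finite $\tau$-structures in which $<$ is a linear order and $\mathrm{add},\mathrm{mult},\mathrm{succ},0$ have their natural meaning relative to it. $\mathrm{arity}(\tau)$ is the maximum arity of a relation symbol in $\tau$. A formula is in negation normal form if negations are applied only to atoms; $x \neq y$ abbreviates $\neg\, x=y$. For a subformula of the form $\forall d(\psi)$ or $\exists d(\psi)$, the variable $d$ is said to depend on all variables free in $\psi$. The leading quantifier of a (sub)formula $\exists x(\psi)$ in negation normal form is strong if (i) some universal quantifier binding inside $\psi$ depends on $x$, or (ii) there is a subformula $\alpha \land \beta$ of $\psi$ such that both $\alpha$ and $\beta$ contain $x$ in literals that are not of the form $x \neq y$ for some variable $y$; otherwise the quantifier is weak. (Universal quantifiers are always strong here.) $\mathrm{qr}$ is quantifier rank; $\mathrm{bound}(\phi)$ is the set of bound variables; $\mathrm{strong\text{-}qr}(\phi)$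 is the quantifier rank of $\phi$ when weak quantifiers are ignored (not counted); $\mathrm{strong\text{-}bound}(\phi)$ is the set of variables of $\phi$ bound by non-weak quantifiers. $O(\mathrm{arity}(\tau))$ denotes a quantity bounded by $c\cdot\mathrm{arity}(\tau)+c$ for an absolute constant $c$. *)

theory Defs
  imports Main
begin

datatype 'c trm = Var nat | Zero | Cst 'c | Succ "'c trm"

datatype ('r, 'c) fm =
    Eq "'c trm" "'c trm"
  | Less "'c trm" "'c trm"
  | Add "'c trm" "'c trm" "'c trm"
  | Mult "'c trm" "'c trm" "'c trm"
  | Rel 'r "'c trm list"
  | Neg "('r, 'c) fm"
  | Conj "('r, 'c) fm" "('r, 'c) fm"
  | Disj "('r, 'c) fm" "('r, 'c) fm"
  | Ex nat "('r, 'c) fm"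
  | All nat "('r, 'c) fm"

fun tvars :: "'c trm \<Rightarrow> nat set" where
  "tvars (Var v) = {v}"
| "tvars Zero = {}"
| "tvars (Cst c) = {}"
| "tvars (Succ t) = tvars t"

fun tconsts :: "'c trm \<Rightarrow> 'c set" where
  "tconsts (Var v) = {}"
| "tconsts Zero = {}"
| "tconsts (Cst c) = {c}"
| "tconsts (Succ t) = tconsts t"

fun is_atom :: "('r, 'c) fm \<Rightarrow> bool" where
  "is_atom (Eq _ _) = True"
| "is_atom (Less _ _) = True"
| "is_atom (Add _ _ _) = True"
| "is_atom (Mult _ _ _) = True"
| "is_atom (Rel _ _) = True"
| "is_atom _ = False"

fun nnf :: "('r, 'c) fm \<Rightarrow> bool" where
  "nnf (Neg a) = is_atom a"
| "nnf (Conj a b) = (nnf a \<and> nnf b)"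
| "nnf (Disj a b) = (nnf a \<and> nnf b)"
| "nnf (Ex x a) = nnf a"
| "nnf (All x a) = nnf a"
| "nnf _ = True"

fun wf_fm :: "'r set \<Rightarrow> ('r \<Rightarrow> nat) \<Rightarrow> 'c set \<Rightarrow> ('r, 'c) fm \<Rightarrow> bool" where
  "wf_fm R ar Cs (Eq s t) = (tconsts s \<union> tconsts t \<subseteq> Cs)"
| "wf_fm R ar Cs (Less s t) = (tconsts s \<union> tconsts t \<subseteq> Cs)"
| "wf_fm R ar Cs (Add s t u) = (tconsts s \<union> tconsts t \<union> tconsts u \<subseteq> Cs)"
| "wf_fm R ar Cs (Mult s t u) = (tconsts s \<union> tconsts t \<union> tconsts u \<subseteq> Cs)"
| "wf_fm R ar Cs (Rel r ts) =
     (r \<in> R \<and> length ts = ar r \<and> (\<forall>t\<in>set ts. tconsts t \<subseteq> Cs))"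
| "wf_fm R ar Cs (Neg a) = wf_fm R ar Cs a"
| "wf_fm R ar Cs (Conj a b) = (wf_fm R ar Cs a \<and> wf_fm R ar Cs b)"
| "wf_fm R ar Cs (Disj a b) = (wf_fm R ar Cs a \<and> wf_fm R ar Cs b)"
| "wf_fm R ar Cs (Ex x a) = wf_fm R ar Cs a"
| "wf_fm R ar Cs (All x a) = wf_fm R ar Cs a"

text \<open>arity(tau): maximum arity of a relation symbol, the built-in add and mult
being ternary (and < binary).\<close>
definition sig_arity :: "'r set \<Rightarrow> ('r \<Rightarrow> nat) \<Rightarrow> nat" where
  "sig_arity R ar = Max (insert 3 (ar ` R))"

text \<open>A structure of size n has universe {0..<n} with its natural order; succ is
the successor, with succ(max) = max.  I interprets the extra relation symbols,
C the extra constants.\<close>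
fun tval :: "nat \<Rightarrow> ('c \<Rightarrow> nat) \<Rightarrow> (nat \<Rightarrow> nat) \<Rightarrow> 'c trm \<Rightarrow> nat" where
  "tval n C e (Var v) = e v"
| "tval n C e Zero = 0"
| "tval n C e (Cst c) = C c"
| "tval n C e (Succ t) = min (tval n C e t + 1) (n - 1)"

fun sat :: "nat \<Rightarrow> ('r \<Rightarrow> nat list \<Rightarrow> bool) \<Rightarrow> ('c \<Rightarrow> nat) \<Rightarrow> (nat \<Rightarrow> nat)
            \<Rightarrow> ('r, 'c) fm \<Rightarrow> bool" where
  "sat n I C e (Eq s t) = (tval n C e s = tval n C e t)"
| "sat n I C e (Less s t) = (tval n C e s < tval n C e t)"
| "sat n I C e (Add s t u) = (tval n C e s + tval n C e t = tval n C e u)"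
| "sat n I C e (Mult s t u) = (tval n C e s * tval n C e t = tval n C e u)"
| "sat n I C e (Rel r ts) = I r (map (tval n C e) ts)"
| "sat n I C e (Neg a) = (\<not> sat n I C e a)"
| "sat n I C e (Conj a b) = (sat n I C e a \<and> sat n I C e b)"
| "sat n I C e (Disj a b) = (sat n I C e a \<or> sat n I C e b)"
| "sat n I C e (Ex x a) = (\<exists>d<n. sat n I C (e(x := d)) a)"
| "sat n I C e (All x a) = (\<forall>d<n. sat n I C (e(x := d)) a)"

definition equiv_fin :: "'c set \<Rightarrow> ('r, 'c) fm \<Rightarrow> ('r, 'c) fm \<Rightarrow> bool" where
  "equiv_fin Cs \<phi> \<psi> \<longleftrightarrow>
     (\<forall>n I C e. 0 < n \<longrightarrow> (\<forall>c\<in>Cs. C c < n) \<longrightarrow> (\<forall>v. e v < n) \<longrightarrow>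
        (sat n I C e \<phi> \<longleftrightarrow> sat n I C e \<psi>))"

fun fv :: "('r, 'c) fm \<Rightarrow> nat set" where
  "fv (Eq s t) = tvars s \<union> tvars t"
| "fv (Less s t) = tvars s \<union> tvars t"
| "fv (Add s t u) = tvars s \<union> tvars t \<union> tvars u"
| "fv (Mult s t u) = tvars s \<union> tvars t \<union> tvars u"
| "fv (Rel r ts) = (\<Union>t\<in>set ts. tvars t)"
| "fv (Neg a) = fv a"
| "fv (Conj a b) = fv a \<union> fv b"
| "fv (Disj a b) = fv a \<union> fv b"
| "fv (Ex x a) = fv a - {x}"
| "fv (All x a) = fv a - {x}"

fun qr :: "('r, 'c) fm \<Rightarrow> nat" where
  "qr (Neg a) = qr a"
| "qr (Conj a b) = max (qr a) (qr b)"
| "qr (Disj a b) = max (qr a) (qr b)"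
| "qr (Ex x a) = qr a + 1"
| "qr (All x a) = qr a + 1"
| "qr _ = 0"

fun bound :: "('r, 'c) fm \<Rightarrow> nat set" where
  "bound (Neg a) = bound a"
| "bound (Conj a b) = bound a \<union> bound b"
| "bound (Disj a b) = bound a \<union> bound b"
| "bound (Ex x a) = insert x (bound a)"
| "bound (All x a) = insert x (bound a)"
| "bound _ = {}"

fun subs_in_scope :: "nat \<Rightarrow> ('r, 'c) fm \<Rightarrow> ('r, 'c) fm set" where
  "subs_in_scope x (Neg a) = insert (Neg a) (subs_in_scope x a)"
| "subs_in_scope x (Conj a b) = insert (Conj a b) (subs_in_scope x a \<union> subs_in_scope x b)"
| "subs_in_scope x (Disj a b) = insert (Disj a b) (subs_in_scope x a \<union> subs_in_scope x b)"
| "subs_in_scope x (Ex y a) = insert (Ex y a) (if y = x then {} else subs_in_scope x a)"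
| "subs_in_scope x (All y a) = insert (All y a) (if y = x then {} else subs_in_scope x a)"
| "subs_in_scope x a = {a}"

fun lits_in_scope :: "nat \<Rightarrow> ('r, 'c) fm \<Rightarrow> ('r, 'c) fm set" where
  "lits_in_scope x (Neg a) = (if is_atom a then {Neg a} else lits_in_scope x a)"
| "lits_in_scope x (Conj a b) = lits_in_scope x a \<union> lits_in_scope x b"
| "lits_in_scope x (Disj a b) = lits_in_scope x a \<union> lits_in_scope x b"
| "lits_in_scope x (Ex y a) = (if y = x then {} else lits_in_scope x a)"
| "lits_in_scope x (All y a) = (if y = x then {} else lits_in_scope x a)"
| "lits_in_scope x a = {a}"

definition is_neq_lit :: "nat \<Rightarrow> ('r, 'c) fm \<Rightarrow> bool" where
  "is_neq_lit x l \<longleftrightarrow> (\<exists>y. l = Neg (Eq (Var x) (Var y)) \<or> l = Neg (Eq (Var y) (Var x)))"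

definition has_relevant_lit :: "nat \<Rightarrow> ('r, 'c) fm \<Rightarrow> bool" where
  "has_relevant_lit x a \<longleftrightarrow> (\<exists>l\<in>lits_in_scope x a. x \<in> fv l \<and> \<not> is_neq_lit x l)"

definition strong_ex :: "nat \<Rightarrow> ('r, 'c) fm \<Rightarrow> bool" where
  "strong_ex x \<psi> \<longleftrightarrow>
     (\<exists>d \<chi>. All d \<chi> \<in> subs_in_scope x \<psi> \<and> x \<in> fv (All d \<chi>)) \<or>
     (\<exists>\<alpha> \<beta>. Conj \<alpha> \<beta> \<in> subs_in_scope x \<psi> \<and> has_relevant_lit x \<alpha> \<and> has_relevant_lit x \<beta>)"

fun strong_qr :: "('r, 'c) fm \<Rightarrow> nat" where
  "strong_qr (Neg a) = strong_qr a"
| "strong_qr (Conj a b) = max (strong_qr a) (strong_qr b)"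
| "strong_qr (Disj a b) = max (strong_qr a) (strong_qr b)"
| "strong_qr (Ex x a) = (if strong_ex x a then strong_qr a + 1 else strong_qr a)"
| "strong_qr (All x a) = strong_qr a + 1"
| "strong_qr _ = 0"

fun strong_bound :: "('r, 'c) fm \<Rightarrow> nat set" where
  "strong_bound (Neg a) = strong_bound a"
| "strong_bound (Conj a b) = strong_bound a \<union> strong_bound b"
| "strong_bound (Disj a b) = strong_bound a \<union> strong_bound b"
| "strong_bound (Ex x a) = (if strong_ex x a then insert x (strong_bound a) else strong_bound a)"
| "strong_bound (All x a) = insert x (strong_bound a)"
| "strong_bound _ = {}"

end

theory Submission
  imports Defs "HOL-Number_Theory.Cong"
begin

text \<open>
  A weak variable x has, along each choice of disjuncts, at most one relevant literal. We push
  its quantifier down to that literal and guard it by a colour; the inequalities involving x are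
  then replaced by inequalities of colours, which is sound for every colouring. A colouring that
  distinguishes the finitely many values of interest is given by two parameters: a modulus p
  of size n to the power epsilon, obtained from an arithmetic progression of pairwise coprime
  numbers, which separates the values, and a number q which encodes the residues of the
  colours by the Chinese remainder theorem, as in Goedel's beta function. Universal quantifiers
  require a fresh choice of p and q, whence the factor 3. The remaining small
  universes are treated by expanding all quantifiers, which leaves no quantifier at all.
\<close>

section \<open>Separating moduli\<close>

text \<open>Pushing a weak quantifier inward splits x into copies: some are quantified locally at
  relevant literals, the others stand in inequalities. Only the colour class still ties the copies
  together, and it has to be named with a number of variables that does not depend on the number of
  weak quantifiers; hence two parameters for a whole colouring. Both must be elements of the
  universe. The number of values to be separated is bounded in terms of the formula, so a modulus of
  size about n^(1/K) exists for any fixed K; K is taken large enough that the product of the k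
  colour moduli, each at most 1 + k p, stays below n, and with it q.

  Witnesses with no universal quantifier in between can be fixed before p and q are chosen. Below a
  universal quantifier they vary with its value, so no single pair serves all values. The new pair
  may forget the old colours: by definition, no weak variable is free in a universally quantified
  subformula of its scope.\<close>

text \<open>The lemma behind Goedel's beta function: eliminating \<open>c\<close> from two members
  of the progression leaves \<open>j - i\<close>, which divides \<open>fact T\<close> and hence
  \<open>c\<close>; a common divisor of \<open>c\<close> and \<open>1 + i * c\<close> is a
  unit.\<close>

lemma coprime_progression:
  fixes c i j :: nat
  assumes "fact T dvd c" "i < j" "j - i \<le> T"
  shows "coprime (1 + i * c) (1 + j * c)"
proof (rule coprimeI)
  fix g assume g: "g dvd 1 + i * c" "g dvd 1 + j * c"
  have "g dvd j * (1 + i * c) - i * (1 + j * c)"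
    using g by (intro dvd_diff_nat dvd_mult)
  also have "j * (1 + i * c) - i * (1 + j * c) = j - i"
    by (simp add: algebra_simps)
  finally have "g dvd j - i" .
  moreover have "j - i dvd fact T"
    using assms by (intro dvd_fact) auto
  ultimately have "g dvd c"
    using assms(1) by (meson dvd_trans)
  then have "g dvd i * c" by simp
  with g(1) show "is_unit g"
    using dvd_add_left_iff by blast
qed

lemma prod_pairwise_coprime_dvd:
  fixes m :: "'i \<Rightarrow> nat"
  assumes "finite A" "\<And>i j. i \<in> A \<Longrightarrow> j \<in> A \<Longrightarrow> i \<noteq> j \<Longrightarrow> coprime (m i) (m j)"
    and "\<And>i. i \<in> A \<Longrightarrow> m i dvd d"
  shows "prod m A dvd d"
  using assms
proof (induction A rule: finite_induct)
  case (insert x F)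
  have "coprime (m x) (prod m F)"
    using insert.hyps insert.prems by (intro prod_coprime_right) auto
  then show ?case
    using insert by (simp add: divides_mult)
qed simp

text \<open>If no modulus separated \<open>S\<close>, each would divide the product of the positive
  differences in \<open>S\<close>, and by coprimality so would the product of all \<open>T\<close>
  moduli. But that exceeds \<open>B ^ T = (B ^ K) ^ (N * N)\<close>, while at most
  \<open>N * N\<close> differences, none above \<open>n\<close>, multiply to at most
  \<open>n ^ (N * N)\<close>.\<close>

lemma progression_separates:
  fixes S :: "nat set"
  assumes S: "S \<subseteq> {..<n}" "card S \<le> N" "0 < T" "T = K * (N * N)"
    and B: "n \<le> B ^ K" "0 < B"
  shows "\<exists>i\<in>{1..T}. inj_on (\<lambda>x. x mod (1 + i * (fact T * B))) S"
proof (rule ccontr)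
  let ?m = "\<lambda>i. 1 + i * (fact T * B)"
  let ?P = "{z \<in> S \<times> S. fst z < snd z}"
  let ?d = "\<Prod>z\<in>?P. snd z - fst z"
  assume "\<not> ?thesis"
  then have bad: "\<not> inj_on (\<lambda>x. x mod ?m i) S" if "i \<in> {1..T}" for i
    using that by blast
  have fin: "finite S" using S(1) finite_subset by blast
  then have finP: "finite ?P" by simp
  have "?m i dvd ?d" if i: "i \<in> {1..T}" for i
  proof -
    obtain x y where xy: "x \<in> S" "y \<in> S" "x < y" "x mod ?m i = y mod ?m i"
      using bad[OF i] unfolding inj_on_def by (metis linorder_neqE_nat)
    then have "?m i dvd y - x"
      by (metis mod_eq_dvd_iff_nat less_imp_le)
    moreover have "y - x dvd ?d"
      using dvd_prodI[OF finP, of "(x, y)" "\<lambda>z. snd z - fst z"] xy by simp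
    ultimately show ?thesis by (rule dvd_trans)
  qed
  moreover have "coprime (?m i) (?m j)" if "i \<in> {1..T}" "j \<in> {1..T}" "i \<noteq> j" for i j
    using that coprime_progression[of T "fact T * B" i j] coprime_progression[of T "fact T * B" j i]
    by (cases i j rule: linorder_cases) (auto simp: coprime_commute)
  ultimately have dvd: "prod ?m {1..T} dvd ?d"
    by (intro prod_pairwise_coprime_dvd) auto
  have pos: "0 < ?d" by (intro prod_pos) auto
  have n: "0 < n"
  proof (rule ccontr)
    assume "\<not> 0 < n"
    then have "S = {}" using S(1) by auto
    then show False using bad[of 1] S(3) by auto
  qed
  have "card ?P \<le> card (S \<times> S)" by (rule card_mono) (use fin in auto)
  also have "\<dots> \<le> N * N" using S(2) by (simp add: card_cartesian_product mult_le_mono)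
  finally have cP: "card ?P \<le> N * N" .
  have "?d \<le> (\<Prod>z\<in>?P. n)" using S(1) by (intro prod_mono) fastforce
  also have "\<dots> \<le> n ^ (N * N)" using cP n by (simp add: power_increasing)
  also have "\<dots> \<le> (B ^ K) ^ (N * N)" using B(1) by (rule power_mono) simp
  also have "\<dots> = (\<Prod>i\<in>{1..T}. B)" using S(4) by (simp add: power_mult)
  also have "\<dots> < prod ?m {1..T}"
  proof (rule prod_mono_strict)
    have lt: "B < ?m i" if i: "i \<in> {1..T}" for i
    proof -
      have "1 * B \<le> (i * fact T) * B" using i by (intro mult_le_mono1) simp
      then have "B \<le> i * (fact T * B)" by (simp only: mult.assoc mult_1)
      then show ?thesis by linarith
    qed
    show "1 \<in> {1..T}" "B < ?m 1" using S(3) lt[of 1] by auto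
    show "0 \<le> B \<and> B \<le> ?m i" if "i \<in> {1..T}" for i
      using lt[OF that] by simp
  qed auto
  finally show False using dvd pos by (simp add: nat_dvd_not_less)
qed

text \<open>With \<open>B\<close> about the K-th root of \<open>n\<close>, the modulus is at most a
  constant times \<open>B\<close>. As \<open>K\<close> is twice \<open>Suc k\<close>, the power
  \<open>(1 + Suc k * p) ^ Suc k\<close> is at most a constant times the square root of
  \<open>n\<close>, hence below \<open>n\<close> for large \<open>n\<close>. The factor
  \<open>fact k\<close> in \<open>p\<close> preserves injectivity and makes the later colour moduli
  pairwise coprime.\<close>

lemma small_separating_modulus:
  fixes k N :: nat
  shows "\<exists>n0. \<forall>n\<ge>n0. \<forall>S. S \<subseteq> {..<n} \<longrightarrow> card S \<le> N \<longrightarrow>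
     (\<exists>p>0. fact k dvd p \<and> inj_on (\<lambda>x. x mod p) S \<and> (1 + Suc k * p) ^ Suc k < n)"
proof -
  define K where "K = 2 * Suc k"
  \<comment> \<open>\<open>Suc N\<close> instead of \<open>N\<close> keeps \<open>T\<close> positive
    when \<open>N = 0\<close>.\<close>
  define T where "T = K * (Suc N * Suc N)"
  \<comment> \<open>\<open>E\<close> and \<open>F\<close> are made for the bounds
    \<open>p \<le> E * B\<close> and \<open>1 + Suc k * p \<le> F * B\<close>.\<close>
  define E where "E = fact k * (1 + T * fact T)"
  define F where "F = 1 + Suc k * E"
  have "\<exists>p>0. fact k dvd p \<and> inj_on (\<lambda>x. x mod p) S \<and> (1 + Suc k * p) ^ Suc k < n"
    if n: "(2 * F) ^ K + 2 \<le> n" and S: "S \<subseteq> {..<n}" "card S \<le> N" for n S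
  proof -
    define B where "B = (LEAST B. n \<le> B ^ K)"
    have "n \<le> n ^ K"
      using n by (intro self_le_power) (auto simp: K_def)
    then have B: "n \<le> B ^ K" unfolding B_def by (rule LeastI)
    have "\<not> B \<le> 1"
    proof
      assume "B \<le> 1"
      then have "B ^ K \<le> 1" by (metis power_mono power_one zero_le)
      then show False using B n by linarith
    qed
    then have B1: "2 \<le> B" by simp
    have less: "(B - 1) ^ K < n"
      using not_less_Least[of "B - 1" "\<lambda>B. n \<le> B ^ K"] B1 unfolding B_def[symmetric] by simp
    \<comment> \<open>Rounding the root up costs at most a factor 2, since
      \<open>B \<ge> 2\<close>.\<close>
    have "B ^ K \<le> (2 * (B - 1)) ^ K" using B1 by (intro power_mono) auto
    also have "\<dots> = 2 ^ K * (B - 1) ^ K" by (simp add: power_mult_distrib)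
    also have "\<dots> \<le> 2 ^ K * n" using less by simp
    finally have Bup: "B ^ K \<le> 2 ^ K * n" .
    have "((F * B) ^ Suc k) ^ 2 = F ^ K * B ^ K"
      by (simp only: K_def power_mult[symmetric] power_mult_distrib[symmetric] mult.commute)
    also have "\<dots> \<le> F ^ K * (2 ^ K * n)" using Bup by simp
    also have "\<dots> = (2 * F) ^ K * n" by (simp add: power_mult_distrib)
    also have "\<dots> < n * n" using n by simp
    finally have FB: "(F * B) ^ Suc k < n"
      by (metis power2_eq_square power_less_imp_less_base zero_le)
    obtain i where i: "i \<in> {1..T}" and inj: "inj_on (\<lambda>x. x mod (1 + i * (fact T * B))) S"
      using progression_separates[of S n "Suc N" T K B] S B B1 by (auto simp: T_def K_def)
    define m where "m = 1 + i * (fact T * B)"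
    have "m \<le> B + T * (fact T * B)"
      unfolding m_def using i B1 by (intro add_mono mult_le_mono1) auto
    also have "\<dots> = (1 + T * fact T) * B" by (simp add: algebra_simps)
    finally have "fact k * m \<le> E * B"
      unfolding E_def by (simp only: mult.assoc mult_le_mono2)
    then have "1 + Suc k * (fact k * m) \<le> B + Suc k * (E * B)"
      using B1 by (intro add_mono mult_le_mono2) auto
    also have "\<dots> = F * B" by (simp add: F_def algebra_simps)
    finally have "(1 + Suc k * (fact k * m)) ^ Suc k \<le> (F * B) ^ Suc k"
      by (rule power_mono) simp
    with FB have "(1 + Suc k * (fact k * m)) ^ Suc k < n" by linarith
    moreover have "inj_on (\<lambda>x. x mod (fact k * m)) S"
    proof (rule inj_onI)
      fix x y assume "x \<in> S" "y \<in> S" "x mod (fact k * m) = y mod (fact k * m)"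
      moreover from this have "x mod m = y mod m"
        by (metis dvd_triv_right mod_mod_cancel)
      ultimately show "x = y" using inj by (auto simp: inj_on_def m_def)
    qed
    ultimately show ?thesis by (intro exI[of _ "fact k * m"]) (simp add: m_def)
  qed
  then show ?thesis by (intro exI[of _ "(2 * F) ^ K + 2"]) blast
qed

section \<open>Colours\<close>

text \<open>For large n, an element v has colour i when v mod p = q mod (1 + (i + 1) p); the clumsy
  form reflects the truncated arithmetic of the universe.\<close>

definition has_colour :: "nat \<Rightarrow> nat \<Rightarrow> nat \<Rightarrow> nat \<Rightarrow> nat \<Rightarrow> bool" where
  "has_colour n p q v i \<longleftrightarrow>
     (\<exists>a<n. min (Suc i) (n - 1) * p = a \<and> (\<exists>r<n. r < p \<and>
        (\<exists>s<n. \<exists>t<n. s * p = t \<and> t + r = v) \<and>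
        (\<exists>s<n. \<exists>t<n. s * min (a + 1) (n - 1) = t \<and> t + r = q)))"

text \<open>Each condition answers one use in the translation: the first makes the intended witness
  pass its colour test, the second makes true the inequalities between a weak and a non-weak
  variable, and the third, which ranges over the whole universe, those between two weak variables.
  Equal witnesses may share a colour class.\<close>

definition separates :: "nat \<Rightarrow> nat \<Rightarrow> nat \<Rightarrow> nat \<Rightarrow> (nat \<Rightarrow> nat) \<Rightarrow> nat set \<Rightarrow> bool" where
  "separates n k p q D V \<longleftrightarrow>
     (\<forall>j<k. has_colour n p q (D j) j) \<and>
     (\<forall>j<k. \<forall>y\<in>V \<union> D ` {..<k}. has_colour n p q y j \<longrightarrow> y = D j) \<and>
     (\<forall>j<k. \<forall>j'<k. \<forall>v<n. has_colour n p q v j \<longrightarrow> has_colour n p q v j' \<longrightarrow> D j = D j')"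

lemma has_colour_iff:
  assumes "0 < p" "Suc i * p + 1 < n" "v < n" "q < n"
  shows "has_colour n p q v i \<longleftrightarrow> v mod p = q mod (1 + Suc i * p)"
proof -
  let ?m = "1 + Suc i * p"
  have "Suc i * 1 \<le> Suc i * p" using assms(1) by (intro mult_le_mono2) simp
  then have m1: "min (Suc i) (n - 1) = Suc i" "min (Suc i * p + 1) (n - 1) = ?m"
    using assms(2) by simp_all
  \<comment> \<open>The formula bounds the common remainder by p only; this makes it a legitimate
    remainder modulo \<open>?m\<close> too.\<close>
  have pm: "p < ?m" by simp
  have div: "(\<exists>s<n. \<exists>t<n. s * d = t \<and> t + r = w) \<longleftrightarrow> w mod d = r"
    if "r < d" "w < n" "0 < d" for r d w
  proof
    assume "w mod d = r"
    moreover have "w div d < n" using that(2) by (meson div_le_dividend le_less_trans)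
    moreover have "w div d * d < n" using that(2) by (meson div_times_less_eq_dividend le_less_trans)
    ultimately show "\<exists>s<n. \<exists>t<n. s * d = t \<and> t + r = w"
      by (metis div_mult_mod_eq)
  qed (use that in auto)
  have "has_colour n p q v i \<longleftrightarrow>
      (\<exists>r<n. r < p \<and> (\<exists>s<n. \<exists>t<n. s * p = t \<and> t + r = v) \<and> (\<exists>s<n. \<exists>t<n. s * ?m = t \<and> t + r = q))"
    unfolding has_colour_def using assms(2) m1 by auto
  also have "\<dots> \<longleftrightarrow> (\<exists>r<n. r < p \<and> v mod p = r \<and> q mod ?m = r)"
  proof (rule ex_cong1)
    fix r
    show "(r < n \<and> r < p \<and> (\<exists>s<n. \<exists>t<n. s * p = t \<and> t + r = v) \<and> (\<exists>s<n. \<exists>t<n. s * ?m = t \<and> t + r = q))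
        \<longleftrightarrow> (r < n \<and> r < p \<and> v mod p = r \<and> q mod ?m = r)"
      using div[of r p v] div[of r ?m q] assms pm by (cases "r < p") auto
  qed
  also have "\<dots> \<longleftrightarrow> v mod p = q mod ?m"
    using assms by (auto intro: le_less_trans[OF mod_less_eq_dividend])
  finally show ?thesis .
qed

text \<open>The Chinese remainder theorem packs the residues \<open>D j mod p\<close> into one
  \<open>q\<close>, reduced modulo the product of the colour moduli and therefore below
  \<open>n\<close>. Colour class j is then the residue class of \<open>D j\<close> modulo
  \<open>p\<close>, and all conditions reduce to injectivity of reduction modulo \<open>p\<close> on
  \<open>V\<close> and the values of \<open>D\<close>.\<close>

lemma ex_separates:
  fixes k N :: nat
  shows "\<exists>n0. \<forall>n\<ge>n0. \<forall>D V. (\<forall>j. D j < n) \<longrightarrow> V \<subseteq> {..<n} \<longrightarrow> finite V \<longrightarrow> card V \<le> N \<longrightarrow>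
     (\<exists>p<n. \<exists>q<n. separates n k p q D V)"
proof -
  obtain n0 where n0: "\<forall>n\<ge>n0. \<forall>S. S \<subseteq> {..<n} \<longrightarrow> card S \<le> N + k \<longrightarrow>
     (\<exists>p>0. fact k dvd p \<and> inj_on (\<lambda>x. x mod p) S \<and> (1 + Suc k * p) ^ Suc k < n)"
    using small_separating_modulus by blast
  have "\<exists>p<n. \<exists>q<n. separates n k p q D V"
    if n: "n \<ge> n0" and D: "\<forall>j. D j < n" and V: "V \<subseteq> {..<n}" "finite V" "card V \<le> N" for n D V
  proof -
    let ?S = "V \<union> D ` {..<k}"
    have "card ?S \<le> card V + card (D ` {..<k})" by (rule card_Un_le)
    also have "\<dots> \<le> N + k" using V(3) card_image_le[of "{..<k}" D] by simp
    finally have "card ?S \<le> N + k" .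
    moreover have "?S \<subseteq> {..<n}" using D V by auto
    ultimately obtain p where p: "0 < p" "fact k dvd p" "inj_on (\<lambda>x. x mod p) ?S"
        "(1 + Suc k * p) ^ Suc k < n"
      using n0[rule_format, OF n, of ?S] by blast
    let ?m = "\<lambda>j. 1 + Suc j * p"
    have cop: "coprime (?m i) (?m j)" if "i < k" "j < k" "i \<noteq> j" for i j
      using that p(2) coprime_progression[of k p "Suc i" "Suc j"]
        coprime_progression[of k p "Suc j" "Suc i"]
      by (cases i j rule: linorder_cases) (auto simp: coprime_commute)
    then obtain x where x: "\<forall>j\<in>{..<k}. [x = D j mod p] (mod ?m j)"
      using chinese_remainder_nat[of "{..<k}" ?m "\<lambda>j. D j mod p"] by auto
    define q where "q = x mod prod ?m {..<k}"
    have "prod ?m {..<k} \<le> (\<Prod>j<k. 1 + Suc k * p)"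
      by (intro prod_mono conjI add_mono mult_le_mono1) auto
    also have "\<dots> \<le> (1 + Suc k * p) ^ Suc k" by simp
    finally have "prod ?m {..<k} < n" using p(4) by linarith
    moreover have "0 < prod ?m {..<k}" by (intro prod_pos) simp
    ultimately have q: "q < n" unfolding q_def by (meson mod_less_divisor less_trans)
    have "1 + Suc k * p \<le> (1 + Suc k * p) ^ Suc k"
      by (rule self_le_power) auto
    then have bnd: "1 + Suc k * p < n" using p(4) by linarith
    have pn: "p < n" using bnd by simp
    have qm: "q mod ?m j = D j mod p" if j: "j < k" for j
    proof -
      have "q mod ?m j = x mod ?m j"
        unfolding q_def by (rule mod_mod_cancel, rule dvd_prodI) (use j in auto)
      also have "\<dots> = D j mod p mod ?m j" using x j by (simp add: cong_def)
      also have "D j mod p < ?m j" using p(1) by (simp add: trans_less_add1 less_SucI)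
      then have "D j mod p mod ?m j = D j mod p" by (rule mod_less)
      finally show ?thesis .
    qed
    have col: "has_colour n p q v j \<longleftrightarrow> v mod p = D j mod p" if "j < k" "v < n" for v j
    proof -
      have "Suc j * p \<le> Suc k * p" using that by (intro mult_le_mono1) simp
      then have "Suc j * p + 1 < n" using bnd by linarith
      then show ?thesis using has_colour_iff[OF p(1) _ that(2) q] qm[OF that(1)] by metis
    qed
    have "separates n k p q D V"
      unfolding separates_def
    proof (intro conjI allI ballI impI)
      show "has_colour n p q (D j) j" if "j < k" for j
        using col that D by auto
      show "y = D j" if "j < k" "y \<in> ?S" "has_colour n p q y j" for j y
        using that col \<open>?S \<subseteq> {..<n}\<close> p(3) by (auto simp: inj_on_def)
      show "D j = D j'" if "j < k" "j' < k" "v < n" "has_colour n p q v j" "has_colour n p q v j'"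
        for j j' v
        using that col p(3) by (auto simp: inj_on_def)
    qed
    with pn q show ?thesis by blast
  qed
  then show ?thesis by blast
qed


section \<open>Substitution and elimination of quantifiers on small universes\<close>

fun num_trm :: "nat \<Rightarrow> 'c trm" where
  "num_trm 0 = Zero"
| "num_trm (Suc j) = Succ (num_trm j)"

lemma tval_num_trm: "0 < n \<Longrightarrow> tval n C e (num_trm j) = min j (n - 1)"
  by (induction j) auto

lemma tconsts_num_trm [simp]: "tconsts (num_trm j) = {}"
  by (induction j) auto

lemma tval_cong: "(\<And>v. v \<in> tvars t \<Longrightarrow> e v = e' v) \<Longrightarrow> tval n C e t = tval n C e' t"
  by (induction t) auto

lemma sat_cong:
  "(\<And>v. v \<in> fv \<phi> \<Longrightarrow> e v = e' v) \<Longrightarrow> sat n I C e \<phi> \<longleftrightarrow> sat n I C e' \<phi>"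
proof (induction \<phi> arbitrary: e e')
  case (Eq s t)
  then show ?case using tval_cong[of s e e'] tval_cong[of t e e'] by simp
next
  case (Less s t)
  then show ?case using tval_cong[of s e e'] tval_cong[of t e e'] by simp
next
  case (Add s t u)
  then show ?case using tval_cong[of s e e'] tval_cong[of t e e'] tval_cong[of u e e'] by simp
next
  case (Mult s t u)
  then show ?case using tval_cong[of s e e'] tval_cong[of t e e'] tval_cong[of u e e'] by simp
next
  case (Rel r ts)
  then have "map (tval n C e) ts = map (tval n C e') ts"
    by (intro map_cong refl tval_cong) auto
  then show ?case by (simp only: sat.simps)
next
  case (Neg \<phi>)
  from Neg.IH[of e e'] Neg.prems show ?case by simp
next
  case (Conj \<phi> \<psi>)
  from Conj.IH(1)[of e e'] Conj.IH(2)[of e e'] Conj.prems show ?case by simp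
next
  case (Disj \<phi> \<psi>)
  from Disj.IH(1)[of e e'] Disj.IH(2)[of e e'] Disj.prems show ?case by simp
next
  case (Ex x \<phi>)
  have "sat n I C (e(x := d)) \<phi> \<longleftrightarrow> sat n I C (e'(x := d)) \<phi>" for d
    by (rule Ex.IH) (use Ex.prems in auto)
  then show ?case by simp
next
  case (All x \<phi>)
  have "sat n I C (e(x := d)) \<phi> \<longleftrightarrow> sat n I C (e'(x := d)) \<phi>" for d
    by (rule All.IH) (use All.prems in auto)
  then show ?case by simp
qed

fun subst_trm :: "(nat \<Rightarrow> 'c trm) \<Rightarrow> 'c trm \<Rightarrow> 'c trm" where
  "subst_trm \<sigma> (Var v) = \<sigma> v"
| "subst_trm \<sigma> Zero = Zero"
| "subst_trm \<sigma> (Cst c) = Cst c"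
| "subst_trm \<sigma> (Succ t) = Succ (subst_trm \<sigma> t)"

fun subst_lit :: "(nat \<Rightarrow> 'c trm) \<Rightarrow> ('r, 'c) fm \<Rightarrow> ('r, 'c) fm" where
  "subst_lit \<sigma> (Eq s t) = Eq (subst_trm \<sigma> s) (subst_trm \<sigma> t)"
| "subst_lit \<sigma> (Less s t) = Less (subst_trm \<sigma> s) (subst_trm \<sigma> t)"
| "subst_lit \<sigma> (Add s t u) = Add (subst_trm \<sigma> s) (subst_trm \<sigma> t) (subst_trm \<sigma> u)"
| "subst_lit \<sigma> (Mult s t u) = Mult (subst_trm \<sigma> s) (subst_trm \<sigma> t) (subst_trm \<sigma> u)"
| "subst_lit \<sigma> (Rel r ts) = Rel r (map (subst_trm \<sigma>) ts)"
| "subst_lit \<sigma> (Neg a) = Neg (subst_lit \<sigma> a)"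
| "subst_lit \<sigma> a = a"

fun is_lit :: "('r, 'c) fm \<Rightarrow> bool" where
  "is_lit (Neg a) = is_atom a"
| "is_lit a = is_atom a"

lemma tval_subst_trm: "tval n C e (subst_trm \<sigma> t) = tval n C (\<lambda>v. tval n C e (\<sigma> v)) t"
  by (induction t) auto

lemma tvars_subst_trm: "tvars (subst_trm \<sigma> t) = (\<Union>v\<in>tvars t. tvars (\<sigma> v))"
  by (induction t) auto

lemma tconsts_subst_trm: "tconsts (subst_trm \<sigma> t) \<subseteq> tconsts t \<union> (\<Union>v. tconsts (\<sigma> v))"
  by (induction t) auto

lemma sat_subst_atom:
  "is_atom a \<Longrightarrow> sat n I C e (subst_lit \<sigma> a) \<longleftrightarrow> sat n I C (\<lambda>v. tval n C e (\<sigma> v)) a"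
  by (cases a) (auto simp: tval_subst_trm comp_def)

lemma sat_subst_lit:
  "is_lit l \<Longrightarrow> sat n I C e (subst_lit \<sigma> l) \<longleftrightarrow> sat n I C (\<lambda>v. tval n C e (\<sigma> v)) l"
  by (cases l) (auto simp: sat_subst_atom simp del: subst_lit.simps(1-5))

lemma fv_subst_lit: "is_lit l \<Longrightarrow> fv (subst_lit \<sigma> l) = (\<Union>v\<in>fv l. tvars (\<sigma> v))"
proof -
  have "is_atom a \<Longrightarrow> fv (subst_lit \<sigma> a) = (\<Union>v\<in>fv a. tvars (\<sigma> v))" for a :: "('a, 'b) fm"
    by (cases a) (auto simp: tvars_subst_trm)
  then show "is_lit l \<Longrightarrow> ?thesis" by (cases l) (auto simp: tvars_subst_trm)
qed

lemma is_atom_subst_lit [simp]: "is_atom (subst_lit \<sigma> a) \<longleftrightarrow> is_atom a"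
  by (cases a) auto

lemma is_lit_subst_lit [simp]: "is_lit (subst_lit \<sigma> l) \<longleftrightarrow> is_lit l"
  by (cases l) auto

lemma wf_subst_lit:
  assumes "\<And>v. tconsts (\<sigma> v) = {}" "wf_fm R ar Cs l"
  shows "wf_fm R ar Cs (subst_lit \<sigma> l)"
proof -
  have "tconsts (subst_trm \<sigma> t) \<subseteq> tconsts t" for t
    using tconsts_subst_trm[of \<sigma> t] assms(1) by auto
  with assms(2) show ?thesis
    by (induction l) (fastforce, fastforce, fastforce, fastforce, fastforce, auto)
qed

lemma qr_lit [simp]: "is_lit l \<Longrightarrow> qr l = 0"
proof -
  have "is_atom a \<Longrightarrow> qr a = 0" for a :: "('a, 'b) fm" by (cases a) auto
  then show "is_lit l \<Longrightarrow> qr l = 0" by (cases l) auto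
qed

lemma bound_lit [simp]: "is_lit l \<Longrightarrow> bound l = {}"
proof -
  have "is_atom a \<Longrightarrow> bound a = {}" for a :: "('a, 'b) fm" by (cases a) auto
  then show "is_lit l \<Longrightarrow> bound l = {}" by (cases l) auto
qed

definition disjs :: "('r, 'c) fm list \<Rightarrow> ('r, 'c) fm" where
  "disjs \<phi>s = foldr Disj \<phi>s (Neg (Eq Zero Zero))"

definition conjs :: "('r, 'c) fm list \<Rightarrow> ('r, 'c) fm" where
  "conjs \<phi>s = foldr Conj \<phi>s (Eq Zero Zero)"

lemma sat_disjs: "sat n I C e (disjs \<phi>s) \<longleftrightarrow> (\<exists>\<phi>\<in>set \<phi>s. sat n I C e \<phi>)"
  unfolding disjs_def by (induction \<phi>s) auto

lemma sat_conjs: "sat n I C e (conjs \<phi>s) \<longleftrightarrow> (\<forall>\<phi>\<in>set \<phi>s. sat n I C e \<phi>)"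
  unfolding conjs_def by (induction \<phi>s) auto

lemma quantifier_free_disjs:
  "(\<And>\<phi>. \<phi> \<in> set \<phi>s \<Longrightarrow> wf_fm R ar Cs \<phi> \<and> qr \<phi> = 0 \<and> bound \<phi> = {})
   \<Longrightarrow> wf_fm R ar Cs (disjs \<phi>s) \<and> qr (disjs \<phi>s) = 0 \<and> bound (disjs \<phi>s) = {}"
  unfolding disjs_def by (induction \<phi>s) auto

lemma quantifier_free_conjs:
  "(\<And>\<phi>. \<phi> \<in> set \<phi>s \<Longrightarrow> wf_fm R ar Cs \<phi> \<and> qr \<phi> = 0 \<and> bound \<phi> = {})
   \<Longrightarrow> wf_fm R ar Cs (conjs \<phi>s) \<and> qr (conjs \<phi>s) = 0 \<and> bound (conjs \<phi>s) = {}"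
  unfolding conjs_def by (induction \<phi>s) auto

fun expand :: "nat \<Rightarrow> (nat \<Rightarrow> 'c trm) \<Rightarrow> ('r, 'c) fm \<Rightarrow> ('r, 'c) fm" where
  "expand n \<sigma> (Conj a b) = Conj (expand n \<sigma> a) (expand n \<sigma> b)"
| "expand n \<sigma> (Disj a b) = Disj (expand n \<sigma> a) (expand n \<sigma> b)"
| "expand n \<sigma> (Ex x a) = disjs (map (\<lambda>j. expand n (\<sigma>(x := num_trm j)) a) [0..<n])"
| "expand n \<sigma> (All x a) = conjs (map (\<lambda>j. expand n (\<sigma>(x := num_trm j)) a) [0..<n])"
| "expand n \<sigma> a = subst_lit \<sigma> a"

lemma nnf_induct [consumes 1, case_names Lit Conj Disj Ex All]:
  assumes "nnf \<phi>"
    and lit: "\<And>l. is_lit l \<Longrightarrow> P l"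
    and "\<And>a b. nnf a \<Longrightarrow> nnf b \<Longrightarrow> P a \<Longrightarrow> P b \<Longrightarrow> P (Conj a b)"
    and "\<And>a b. nnf a \<Longrightarrow> nnf b \<Longrightarrow> P a \<Longrightarrow> P b \<Longrightarrow> P (Disj a b)"
    and "\<And>x a. nnf a \<Longrightarrow> P a \<Longrightarrow> P (Ex x a)"
    and "\<And>x a. nnf a \<Longrightarrow> P a \<Longrightarrow> P (All x a)"
  shows "P \<phi>"
  using assms(1)
proof (induction \<phi>)
  case (Neg a)
  then show ?case by (intro lit) simp
qed (use assms in \<open>auto intro: lit\<close>)

lemma expand_lit: "is_lit l \<Longrightarrow> expand n \<sigma> l = subst_lit \<sigma> l"
  by (cases l) auto

lemma sat_expand:
  assumes "nnf \<phi>" "0 < n"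
  shows "sat n I C e (expand n \<sigma> \<phi>) \<longleftrightarrow> sat n I C (\<lambda>v. tval n C e (\<sigma> v)) \<phi>"
  using assms(1)
proof (induction \<phi> arbitrary: \<sigma> rule: nnf_induct)
  have upd: "(\<lambda>v. tval n C e ((\<sigma>(x := num_trm j)) v)) = (\<lambda>v. tval n C e (\<sigma> v))(x := j)"
    if "j < n" for \<sigma> x j
    using that assms(2) by (auto simp: tval_num_trm fun_eq_iff)
  {
    case (Lit l)
    then show ?case by (simp add: expand_lit sat_subst_lit)
  next
    case (Ex x a)
    have "sat n I C e (expand n (\<sigma>(x := num_trm d)) a) \<longleftrightarrow> sat n I C ((\<lambda>v. tval n C e (\<sigma> v))(x := d)) a"
      if "d < n" for d
      by (simp only: Ex.IH upd[OF that])
    then show ?case by (auto simp: sat_disjs)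
  next
    case (All x a)
    have "sat n I C e (expand n (\<sigma>(x := num_trm d)) a) \<longleftrightarrow> sat n I C ((\<lambda>v. tval n C e (\<sigma> v))(x := d)) a"
      if "d < n" for d
      by (simp only: All.IH upd[OF that])
    then show ?case by (auto simp: sat_conjs)
  }
qed simp_all

lemma quantifier_free_expand:
  assumes "nnf \<phi>" "wf_fm R ar Cs \<phi>" "\<And>v. tconsts (\<sigma> v) = {}"
  shows "wf_fm R ar Cs (expand n \<sigma> \<phi>) \<and> qr (expand n \<sigma> \<phi>) = 0 \<and> bound (expand n \<sigma> \<phi>) = {}"
  using assms
proof (induction \<phi> arbitrary: \<sigma> rule: nnf_induct)
  case (Lit l)
  then show ?case by (simp add: expand_lit wf_subst_lit)
next
  case (Ex x a)
  then show ?case by (auto intro!: quantifier_free_disjs simp del: fun_upd_apply) (simp add: fun_upd_def)+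
next
  case (All x a)
  then show ?case by (auto intro!: quantifier_free_conjs simp del: fun_upd_apply) (simp add: fun_upd_def)+
qed simp_all

section \<open>Patching the finitely many small universes\<close>

definition equiv_at :: "nat \<Rightarrow> 'c set \<Rightarrow> ('r, 'c) fm \<Rightarrow> ('r, 'c) fm \<Rightarrow> bool" where
  "equiv_at n Cs \<phi> \<psi> \<longleftrightarrow>
     (\<forall>I C e. (\<forall>c\<in>Cs. C c < n) \<longrightarrow> (\<forall>v. e v < n) \<longrightarrow> (sat n I C e \<phi> \<longleftrightarrow> sat n I C e \<psi>))"

text \<open>The threshold is lowered by one universe size at a time. The patch for a fixed size is
  quantifier-free, so rank and bound variables do not change.\<close>

lemma equiv_finI_large:
  assumes "nnf \<phi>" "wf_fm R ar Cs \<phi>" "wf_fm R ar Cs \<psi>" "\<And>n. N < n \<Longrightarrow> equiv_at n Cs \<phi> \<psi>"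
  shows "\<exists>\<psi>'. wf_fm R ar Cs \<psi>' \<and> qr \<psi>' = qr \<psi> \<and> bound \<psi>' = bound \<psi> \<and> equiv_fin Cs \<phi> \<psi>'"
  using assms(3,4)
proof (induction N arbitrary: \<psi>)
  case 0
  then show ?case by (auto simp: equiv_fin_def equiv_at_def)
next
  case (Suc N)
  \<comment> \<open>Because of the truncated successor, this holds exactly when the universe has
    more than \<open>Suc N\<close> elements; among sizes above \<open>N\<close> it fails only at
    \<open>Suc N\<close>.\<close>
  let ?L = "Less (num_trm N) (num_trm (Suc N)) :: ('a, 'b) fm"
  let ?\<psi> = "Disj (Conj (Neg ?L) (expand (Suc N) Var \<phi>)) (Conj ?L \<psi>)"
  have qf: "wf_fm R ar Cs (expand (Suc N) Var \<phi>)" "qr (expand (Suc N) Var \<phi>) = 0"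
      "bound (expand (Suc N) Var \<phi>) = {}"
    using quantifier_free_expand[OF assms(1,2), of Var "Suc N"] by auto
  have "equiv_at n Cs \<phi> ?\<psi>" if n: "N < n" for n
  proof (cases "n = Suc N")
    case True
    then show ?thesis
      by (simp add: equiv_at_def tval_num_trm sat_expand[OF assms(1)] del: num_trm.simps)
  next
    case False
    then show ?thesis
      using n Suc.prems(2)[of n] by (auto simp: equiv_at_def tval_num_trm simp del: num_trm.simps)
  qed
  then obtain \<psi>' where "wf_fm R ar Cs \<psi>'" "qr \<psi>' = qr ?\<psi>" "bound \<psi>' = bound ?\<psi>"
      "equiv_fin Cs \<phi> \<psi>'"
    using Suc.IH[of ?\<psi>] Suc.prems(1) qf by auto
  then show ?case using qf by auto
qed


section \<open>Removing weak quantifiers\<close>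

text \<open>All variables of the given formula are below b. The variables b and b + 1 hold the
  parameters p and q, the variables b + 2, ..., b + 5 are local to colour formulas, b + 6 is a
  dummy, and b + 7, ... rename the weak variables of a literal.\<close>

definition colour_fm :: "nat \<Rightarrow> nat \<Rightarrow> nat \<Rightarrow> ('r, 'c) fm" where
  "colour_fm b v i =
     Ex (b + 2) (Conj (Mult (num_trm (Suc i)) (Var b) (Var (b + 2)))
       (Ex (b + 3) (Conj (Less (Var (b + 3)) (Var b))
         (Conj (Ex (b + 4) (Ex (b + 5) (Conj (Mult (Var (b + 4)) (Var b) (Var (b + 5)))
                  (Add (Var (b + 5)) (Var (b + 3)) (Var v)))))
               (Ex (b + 4) (Ex (b + 5) (Conj (Mult (Var (b + 4)) (Succ (Var (b + 2))) (Var (b + 5)))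
                  (Add (Var (b + 5)) (Var (b + 3)) (Var (b + 1))))))))))"

lemma sat_colour_fm:
  assumes "0 < n" "v \<notin> {b..b + 5}"
  shows "sat n I C e (colour_fm b v i) \<longleftrightarrow> has_colour n (e b) (e (b + 1)) (e v) i"
proof -
  have "v \<noteq> b + 2" "v \<noteq> b + 3" "v \<noteq> b + 4" "v \<noteq> b + 5" using assms(2) by auto
  then show ?thesis
    using assms(1)
    by (simp add: colour_fm_def has_colour_def tval_num_trm del: num_trm.simps)
qed

lemma wf_colour_fm [simp]: "wf_fm R ar Cs (colour_fm b v i)"
  and qr_colour_fm [simp]: "qr (colour_fm b v i) = 4"
  and bound_colour_fm [simp]: "bound (colour_fm b v i) = {b + 2, b + 3, b + 4, b + 5}"
  by (auto simp: colour_fm_def)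

text \<open>Renaming makes all literals share one block of at most arity many names; under their
  original names the weak variables would count as bound variables of the result.\<close>

fun guard :: "nat \<Rightarrow> (nat \<Rightarrow> nat option) \<Rightarrow> nat \<Rightarrow> nat list \<Rightarrow> ('r, 'c) fm \<Rightarrow> ('r, 'c) fm" where
  "guard b \<gamma> k [] l = l"
| "guard b \<gamma> k (x # xs) l =
     Ex (b + 7 + k) (Conj (colour_fm b (b + 7 + k) (the (\<gamma> x)))
       (guard b \<gamma> (Suc k) xs (subst_lit (Var(x := Var (b + 7 + k))) l)))"

lemma sat_guard:
  assumes "0 < n" "distinct xs" "set xs \<subseteq> {..<b}" "fv l \<subseteq> {..<b + 7 + k}" "is_lit l"
  shows "sat n I C e (guard b \<gamma> k xs l) \<longleftrightarrow>
     (\<exists>a. (\<forall>x\<in>set xs. a x < n \<and> has_colour n (e b) (e (b + 1)) (a x) (the (\<gamma> x))) \<and>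
          sat n I C (\<lambda>v. if v \<in> set xs then a v else e v) l)"
  using assms(2-)
proof (induction xs arbitrary: k l e)
  case (Cons x xs)
  let ?w = "b + 7 + k"
  let ?l = "subst_lit (Var(x := Var ?w)) l :: ('a, 'b) fm"
  have w: "?w \<notin> set xs" "x \<notin> set xs" "x \<noteq> ?w" "?w \<notin> fv l" using Cons.prems by auto
  have "fv ?l \<subseteq> {..<b + 7 + Suc k}"
    using Cons.prems by (auto simp: fv_subst_lit split: if_splits)
  then have IH: "sat n I C e' (guard b \<gamma> (Suc k) xs ?l) \<longleftrightarrow>
     (\<exists>a. (\<forall>x\<in>set xs. a x < n \<and> has_colour n (e' b) (e' (b + 1)) (a x) (the (\<gamma> x))) \<and>
          sat n I C (\<lambda>v. if v \<in> set xs then a v else e' v) ?l)" for e'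
    using Cons.prems by (intro Cons.IH) auto
  have eq: "sat n I C (\<lambda>v. if v \<in> set xs then a v else (e(?w := d)) v) ?l \<longleftrightarrow>
      sat n I C (\<lambda>v. if v \<in> set (x # xs) then (a(x := d)) v else e v) l" for a d
    unfolding sat_subst_lit[OF Cons.prems(4)] using w by (intro sat_cong) auto
  have "sat n I C e (guard b \<gamma> k (x # xs) l) \<longleftrightarrow>
      (\<exists>d<n. has_colour n (e b) (e (b + 1)) d (the (\<gamma> x)) \<and>
        (\<exists>a. (\<forall>x\<in>set xs. a x < n \<and> has_colour n (e b) (e (b + 1)) (a x) (the (\<gamma> x))) \<and>
          sat n I C (\<lambda>v. if v \<in> set (x # xs) then (a(x := d)) v else e v) l))"
    by (simp add: sat_colour_fm[OF assms(1)] IH eq[simplified] del: fun_upd_apply)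
       (simp add: fun_upd_def)
  also have "\<dots> \<longleftrightarrow> (\<exists>a. (\<forall>x\<in>set (x # xs). a x < n \<and> has_colour n (e b) (e (b + 1)) (a x) (the (\<gamma> x))) \<and>
          sat n I C (\<lambda>v. if v \<in> set (x # xs) then a v else e v) l)"
  proof (intro iffI; elim exE conjE)
    fix d a
    assume "d < n" "has_colour n (e b) (e (b + 1)) d (the (\<gamma> x))"
      "\<forall>x\<in>set xs. a x < n \<and> has_colour n (e b) (e (b + 1)) (a x) (the (\<gamma> x))"
      "sat n I C (\<lambda>v. if v \<in> set (x # xs) then (a(x := d)) v else e v) l"
    then show "\<exists>a. (\<forall>x\<in>set (x # xs). a x < n \<and> has_colour n (e b) (e (b + 1)) (a x) (the (\<gamma> x))) \<and>
          sat n I C (\<lambda>v. if v \<in> set (x # xs) then a v else e v) l"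
      using w by (intro exI[of _ "a(x := d)"]) auto
  next
    fix a
    assume "\<forall>x\<in>set (x # xs). a x < n \<and> has_colour n (e b) (e (b + 1)) (a x) (the (\<gamma> x))"
      "sat n I C (\<lambda>v. if v \<in> set (x # xs) then a v else e v) l"
    then show "\<exists>d<n. has_colour n (e b) (e (b + 1)) d (the (\<gamma> x)) \<and>
        (\<exists>a. (\<forall>x\<in>set xs. a x < n \<and> has_colour n (e b) (e (b + 1)) (a x) (the (\<gamma> x))) \<and>
          sat n I C (\<lambda>v. if v \<in> set (x # xs) then (a(x := d)) v else e v) l)"
      by (intro exI[of _ "a x"] conjI exI[of _ a]) (simp_all only: fun_upd_triv, auto)
  qed
  finally show ?case .
qed simp

lemma qr_guard: "is_lit l \<Longrightarrow> qr (guard b \<gamma> k xs l) \<le> length xs + 4"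
proof (induction xs arbitrary: k l)
  case (Cons x xs)
  from Cons.IH[of "subst_lit (Var(x := Var (b + 7 + k))) l" "Suc k"] Cons.prems show ?case by simp
qed simp

lemma bound_guard:
  "is_lit l \<Longrightarrow> bound (guard b \<gamma> k xs l) \<subseteq> {b..<b + 7 + k + length xs}"
proof (induction xs arbitrary: k l)
  case (Cons x xs)
  have "bound (guard b \<gamma> (Suc k) xs (subst_lit (Var(x := Var (b + 7 + k))) l))
      \<subseteq> {b..<b + 7 + Suc k + length xs}"
    by (rule Cons.IH) (use Cons.prems in simp)
  then show ?case by auto
qed simp

lemma wf_guard: "is_lit l \<Longrightarrow> wf_fm R ar Cs l \<Longrightarrow> wf_fm R ar Cs (guard b \<gamma> k xs l)"
proof (induction xs arbitrary: k l)
  case (Cons x xs)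
  then show ?case by (auto intro!: Cons.IH wf_subst_lit split: if_splits)
qed simp

text \<open>The partial function \<open>\<gamma>\<close> assigns to each weak variable in scope the index of its
  colour class.\<close>

definition weak_lit :: "nat \<Rightarrow> (nat \<Rightarrow> nat option) \<Rightarrow> ('r, 'c) fm \<Rightarrow> ('r, 'c) fm" where
  "weak_lit b \<gamma> l =
     (case l of
        Neg (Eq (Var x) (Var y)) \<Rightarrow>
          (case \<gamma> x of
             None \<Rightarrow> (case \<gamma> y of None \<Rightarrow> l | Some j \<Rightarrow> Neg (colour_fm b x j))
           | Some i \<Rightarrow> (case \<gamma> y of
               None \<Rightarrow> Neg (colour_fm b y i)
             | Some j \<Rightarrow> Neg (Ex (b + 6) (Conj (colour_fm b (b + 6) i) (colour_fm b (b + 6) j)))))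
      | _ \<Rightarrow> guard b \<gamma> 0 (sorted_list_of_set (fv l \<inter> dom \<gamma>)) l)"

text \<open>For two weak variables the translation says that the classes have no common element.
  Comparing the indices i and j would not do, since different quantifiers may have the same
  witness.\<close>

lemma weak_lit_neq:
  "weak_lit b \<gamma> (Neg (Eq (Var x) (Var y))) =
     (case \<gamma> x of
        None \<Rightarrow> (case \<gamma> y of None \<Rightarrow> Neg (Eq (Var x) (Var y)) | Some j \<Rightarrow> Neg (colour_fm b x j))
      | Some i \<Rightarrow> (case \<gamma> y of
          None \<Rightarrow> Neg (colour_fm b y i)
        | Some j \<Rightarrow> Neg (Ex (b + 6) (Conj (colour_fm b (b + 6) i) (colour_fm b (b + 6) j)))))"
  by (simp add: weak_lit_def)

lemma weak_lit_guard:
  "(\<And>x y. l \<noteq> Neg (Eq (Var x) (Var y))) \<Longrightarrow>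
     weak_lit b \<gamma> l = guard b \<gamma> 0 (sorted_list_of_set (fv l \<inter> dom \<gamma>)) l"
  by (auto simp: weak_lit_def split: fm.splits trm.splits)

text \<open>Quantifiers below a universal one are counted too, although indices restart there; a
  single k then bounds the indices everywhere.\<close>

fun num_ex :: "('r, 'c) fm \<Rightarrow> nat" where
  "num_ex (Neg a) = num_ex a"
| "num_ex (Conj a b) = num_ex a + num_ex b"
| "num_ex (Disj a b) = num_ex a + num_ex b"
| "num_ex (Ex x a) = Suc (num_ex a)"
| "num_ex (All x a) = num_ex a"
| "num_ex _ = 0"

text \<open>The index i is the first one available for the quantifiers of the formula; strong
  existential quantifiers consume an index as well, so that the indexed witnesses include all
  values that the hashing has to separate.\<close>

fun remove_weak :: "nat \<Rightarrow> (nat \<Rightarrow> nat option) \<Rightarrow> nat \<Rightarrow> ('r, 'c) fm \<Rightarrow> ('r, 'c) fm" where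
  "remove_weak b \<gamma> i (Conj \<phi> \<psi>) = Conj (remove_weak b \<gamma> i \<phi>) (remove_weak b \<gamma> (i + num_ex \<phi>) \<psi>)"
| "remove_weak b \<gamma> i (Disj \<phi> \<psi>) = Disj (remove_weak b \<gamma> i \<phi>) (remove_weak b \<gamma> (i + num_ex \<phi>) \<psi>)"
| "remove_weak b \<gamma> i (Ex x \<phi>) =
     (if strong_ex x \<phi> then Ex x (remove_weak b (\<gamma>(x := None)) (Suc i) \<phi>)
      else Conj (Ex (b + 6) (colour_fm b (b + 6) i)) (remove_weak b (\<gamma>(x \<mapsto> i)) (Suc i) \<phi>))"
| "remove_weak b \<gamma> i (All x \<phi>) =
     All x (Ex b (Ex (b + 1) (remove_weak b Map.empty 0 \<phi>)))"
| "remove_weak b \<gamma> i l = weak_lit b \<gamma> l"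

section \<open>Rank and bound variables of the translation\<close>

lemma remove_weak_lit: "is_lit l \<Longrightarrow> remove_weak b \<gamma> i l = weak_lit b \<gamma> l"
  by (cases l) auto

lemma finite_tvars: "finite (tvars t)"
  by (induction t) auto

lemma card_tvars: "card (tvars t) \<le> 1"
  by (induction t) auto

lemma finite_fv: "finite (fv \<phi>)"
  by (induction \<phi>) (auto simp: finite_tvars)

lemma finite_bound: "finite (bound \<phi>)"
  by (induction \<phi>) auto

lemma finite_strong_bound: "finite (strong_bound \<phi>)"
  by (induction \<phi>) auto

lemma sig_arity_ge: "finite R \<Longrightarrow> 3 \<le> sig_arity R ar" "finite R \<Longrightarrow> r \<in> R \<Longrightarrow> ar r \<le> sig_arity R ar"
  by (auto simp: sig_arity_def intro: Max_ge)

lemma card_fv_lit: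
  assumes "is_lit l" "wf_fm R ar Cs l" "finite R"
  shows "card (fv l) \<le> sig_arity R ar"
proof -
  note t = card_tvars
  have 2: "card (tvars s \<union> tvars t) \<le> 2" for s t :: "'b trm"
    using card_Un_le[of "tvars s" "tvars t"] t[of s] t[of t] by linarith
  have 3: "card (tvars s \<union> tvars t \<union> tvars u) \<le> 3" for s t u :: "'b trm"
    using card_Un_le[of "tvars s \<union> tvars t" "tvars u"] 2[of s t] t[of u] by linarith
  have rel: "card (\<Union>t\<in>set ts. tvars t) \<le> length ts" for ts :: "'b trm list"
  proof (induction ts)
    case (Cons s ts)
    then show ?case
      using card_Un_le[of "tvars s" "\<Union>t\<in>set ts. tvars t"] t[of s] by simp
  qed simp
  have A: "3 \<le> sig_arity R ar" using sig_arity_ge(1)[OF assms(3)] .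
  have atom: "card (fv a) \<le> sig_arity R ar" if "is_atom a" "wf_fm R ar Cs a" for a :: "('a, 'b) fm"
  proof (cases a)
    case (Eq s t)
    then show ?thesis using 2[of s t] A by simp
  next
    case (Less s t)
    then show ?thesis using 2[of s t] A by simp
  next
    case (Add s t u)
    then show ?thesis using 3[of s t u] A by simp
  next
    case (Mult s t u)
    then show ?thesis using 3[of s t u] A by simp
  next
    case (Rel r ts)
    then show ?thesis
      using rel[of ts] sig_arity_ge(2)[OF assms(3), of r ar] that(2) by simp
  qed (use that in auto)
  show ?thesis
  proof (cases "is_atom l")
    case False
    then obtain a where "l = Neg a" "is_atom a" using assms(1) by (cases l) auto
    then show ?thesis using atom[of a] assms(2) by simp
  qed (rule atom[OF _ assms(2)])
qed

lemma weak_lit_bounds: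
  assumes "is_lit l" "wf_fm R ar Cs l" "finite R"
  shows "wf_fm R ar Cs (weak_lit b \<gamma> l) \<and> qr (weak_lit b \<gamma> l) \<le> sig_arity R ar + 4 \<and>
    bound (weak_lit b \<gamma> l) \<subseteq> {b..<b + 7 + sig_arity R ar}"
proof (cases "\<exists>x y. l = Neg (Eq (Var x) (Var y))")
  case True
  then show ?thesis
    using sig_arity_ge(1)[OF assms(3), of ar]
    by (auto simp: weak_lit_neq split: option.splits)
next
  case False
  let ?xs = "sorted_list_of_set (fv l \<inter> dom \<gamma>)"
  have "length ?xs \<le> card (fv l)"
    using card_mono[OF finite_fv, of "fv l \<inter> dom \<gamma>" l] by simp
  also have "\<dots> \<le> sig_arity R ar" using card_fv_lit[OF assms] .
  finally have "length ?xs \<le> sig_arity R ar" .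
  then show ?thesis
    using False qr_guard[OF assms(1), of b \<gamma> 0 ?xs] bound_guard[OF assms(1), of b \<gamma> 0 ?xs]
      wf_guard[OF assms(1,2), of b \<gamma> 0 ?xs]
    by (fastforce simp: weak_lit_guard)
qed

text \<open>A universal quantifier costs three, a strong existential one costs one, and a weak one
  costs nothing: its colour test stands beside the translated body, not above it. The lower
  inclusion is needed because the final estimate for the bound variables is two-sided.\<close>

lemma remove_weak_bounds:
  assumes "nnf \<phi>" "wf_fm R ar Cs \<phi>" "finite R"
  shows "wf_fm R ar Cs (remove_weak b \<gamma> i \<phi>) \<and>
    qr (remove_weak b \<gamma> i \<phi>) \<le> 3 * strong_qr \<phi> + sig_arity R ar + 5 \<and>
    strong_bound \<phi> \<subseteq> bound (remove_weak b \<gamma> i \<phi>) \<and>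
    bound (remove_weak b \<gamma> i \<phi>) \<subseteq> strong_bound \<phi> \<union> {b..<b + 7 + sig_arity R ar}"
  using assms(1,2)
proof (induction \<phi> arbitrary: \<gamma> i rule: nnf_induct)
  case (Lit l)
  have a: "strong_qr a = 0 \<and> strong_bound a = {}" if "is_atom a" for a :: "('a, 'b) fm"
    using that by (cases a) auto
  have "strong_qr l = 0 \<and> strong_bound l = {}" using a Lit.hyps by (cases l) auto
  then show ?case
    using weak_lit_bounds[OF Lit.hyps Lit.prems assms(3), of b \<gamma>]
    by (auto simp: remove_weak_lit[OF Lit.hyps])
next
  case (Conj \<phi> \<psi>)
  from Conj.IH(1)[of \<gamma> i] Conj.IH(2)[of \<gamma> "i + num_ex \<phi>"] Conj.prems show ?case
    by auto
next
  case (Disj \<phi> \<psi>)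
  from Disj.IH(1)[of \<gamma> i] Disj.IH(2)[of \<gamma> "i + num_ex \<phi>"] Disj.prems show ?case
    by auto
next
  case (Ex x \<phi>)
  show ?case
  proof (cases "strong_ex x \<phi>")
    case True
    then show ?thesis
      using Ex.IH[of "\<gamma>(x := None)" "Suc i"] Ex.prems by (auto simp del: fun_upd_apply)
  next
    case False
    then show ?thesis
      using Ex.IH[of "\<gamma>(x \<mapsto> i)" "Suc i"] Ex.prems sig_arity_ge(1)[OF assms(3), of ar]
      by (auto simp del: fun_upd_apply)
  qed
next
  case (All x \<phi>)
  from All.IH[of Map.empty 0] All.prems sig_arity_ge(1)[OF assms(3), of ar]
  show ?case by auto
qed


section \<open>Soundness of the translation\<close>

lemma has_relevant_lit_simps [simp]:
  "has_relevant_lit x (Conj a b) \<longleftrightarrow> has_relevant_lit x a \<or> has_relevant_lit x b"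
  "has_relevant_lit x (Disj a b) \<longleftrightarrow> has_relevant_lit x a \<or> has_relevant_lit x b"
  "has_relevant_lit x (Ex y a) \<longleftrightarrow> y \<noteq> x \<and> has_relevant_lit x a"
  by (auto simp: has_relevant_lit_def)

lemma has_relevant_lit_lit:
  "is_lit l \<Longrightarrow> has_relevant_lit x l \<longleftrightarrow> x \<in> fv l \<and> \<not> is_neq_lit x l"
proof -
  assume "is_lit l"
  moreover have "lits_in_scope x a = {a}" if "is_atom a" for a :: "('a, 'b) fm"
    using that by (cases a) auto
  ultimately have "lits_in_scope x l = {l}" by (cases l) auto
  then show ?thesis by (simp add: has_relevant_lit_def)
qed

lemma weak_Conj:
  assumes "\<not> strong_ex x (Conj a b)"
  shows "\<not> strong_ex x a" "\<not> strong_ex x b" "\<not> (has_relevant_lit x a \<and> has_relevant_lit x b)"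
  using assms by (auto simp: strong_ex_def)

lemma weak_Disj:
  assumes "\<not> strong_ex x (Disj a b)"
  shows "\<not> strong_ex x a" "\<not> strong_ex x b"
  using assms by (auto simp: strong_ex_def)

lemma weak_Ex: "\<not> strong_ex x (Ex y a) \<Longrightarrow> y \<noteq> x \<Longrightarrow> \<not> strong_ex x a"
  by (auto simp: strong_ex_def)

text \<open>This is why \<open>remove_weak\<close> may reset the colouring to
  \<open>Map.empty\<close> below a universal quantifier.\<close>

lemma weak_All: "\<not> strong_ex x (All y a) \<Longrightarrow> x \<notin> fv (All y a)"
  by (auto simp: strong_ex_def)

definition override :: "(nat \<Rightarrow> nat) \<Rightarrow> (nat \<Rightarrow> nat option) \<Rightarrow> (nat \<Rightarrow> nat) \<Rightarrow> nat \<Rightarrow> nat" where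
  "override e \<gamma> a = (\<lambda>v. if \<gamma> v = None then e v else a v)"

text \<open>A witness w is binding only for the variables with relevant literals; the others range
  freely over their colour class. This lets the witnesses for the two sides of a conjunction be
  merged, as no weak variable is relevant on both sides.\<close>

definition coloured_ext ::
  "(nat \<Rightarrow> nat \<Rightarrow> bool) \<Rightarrow> (nat \<Rightarrow> nat option) \<Rightarrow> (nat \<Rightarrow> bool) \<Rightarrow> (nat \<Rightarrow> nat) \<Rightarrow> (nat \<Rightarrow> nat) \<Rightarrow> bool" where
  "coloured_ext col \<gamma> rel w a \<longleftrightarrow> (\<forall>x i. \<gamma> x = Some i \<longrightarrow> col (a x) i \<and> (rel x \<longrightarrow> a x = w x))"

text \<open>This is what the conjunct \<open>Ex (b + 6) (colour_fm b (b + 6) i)\<close> of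
  \<open>remove_weak\<close> provides. A weak variable that occurs only in inequalities gets no
  guard, and an empty class would make its translated inequalities vacuously true.\<close>

definition inhabited :: "(nat \<Rightarrow> nat \<Rightarrow> bool) \<Rightarrow> (nat \<Rightarrow> nat option) \<Rightarrow> bool" where
  "inhabited col \<gamma> \<longleftrightarrow> (\<forall>x i. \<gamma> x = Some i \<longrightarrow> (\<exists>v. col v i))"

lemma inhabitedE:
  assumes "inhabited col \<gamma>"
  obtains c where "\<And>x i. \<gamma> x = Some i \<Longrightarrow> col (c x) i"
proof -
  have "\<forall>x. \<exists>v. \<forall>i. \<gamma> x = Some i \<longrightarrow> col v i"
    using assms unfolding inhabited_def by (metis option.inject)
  then show ?thesis using that by metis
qed

definition weak_witness ::
  "nat \<Rightarrow> ('r \<Rightarrow> nat list \<Rightarrow> bool) \<Rightarrow> ('c \<Rightarrow> nat) \<Rightarrow> (nat \<Rightarrow> nat) \<Rightarrow> (nat \<Rightarrow> nat \<Rightarrow> bool) \<Rightarrow>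
   (nat \<Rightarrow> nat option) \<Rightarrow> ('r, 'c) fm \<Rightarrow> (nat \<Rightarrow> nat) \<Rightarrow> bool" where
  "weak_witness n I C e col \<gamma> \<phi> w \<longleftrightarrow>
     (\<forall>x i. \<gamma> x = Some i \<longrightarrow> col (w x) i) \<and>
     (\<forall>a. coloured_ext col \<gamma> (\<lambda>x. has_relevant_lit x \<phi>) w a \<longrightarrow> sat n I C (override e \<gamma> a) \<phi>)"

text \<open>An inequality between variables has no relevant variable, so it must hold for all
  choices from the classes, which is what its translation says. In any other literal every variable
  is relevant and the guard supplies its value; weak variables absent from the literal take any
  value of their class.\<close>

lemma weak_lit_sound:
  fixes l :: "('r, 'c) fm"
  assumes "is_lit l" "0 < n" "fv l \<subseteq> {..<b}" "sat n I C e (weak_lit b \<gamma> l)"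
  defines "col \<equiv> \<lambda>v i. v < n \<and> has_colour n (e b) (e (b + 1)) v i"
  assumes "inhabited col \<gamma>"
  shows "\<exists>w. weak_witness n I C e col \<gamma> l w"
proof (cases "\<exists>x y. l = Neg (Eq (Var x) (Var y))")
  case True
  then obtain x y where l: "l = Neg (Eq (Var x) (Var y))" by blast
  have sc: "sat n I C e' (colour_fm b v i) \<longleftrightarrow> has_colour n (e' b) (e' (b + 1)) (e' v) i"
    if "v < b \<or> v = b + 6" for e' v i
    using that by (intro sat_colour_fm assms(2)) auto
  have xy: "x < b" "y < b" using assms(3) l by auto
  have "has_relevant_lit z l = False" for z
    using has_relevant_lit_lit[OF assms(1)] l by (auto simp: is_neq_lit_def)
  moreover have "sat n I C (override e \<gamma> a) l" if "coloured_ext col \<gamma> (\<lambda>_. False) w a" for w a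
    using that assms(4) xy
    by (auto simp: l weak_lit_neq sc override_def coloured_ext_def col_def split: option.splits;
        metis)
  moreover obtain c where "\<And>x i. \<gamma> x = Some i \<Longrightarrow> col (c x) i"
    using inhabitedE[OF assms(6)] by blast
  ultimately show ?thesis by (auto simp: weak_witness_def)
next
  case False
  let ?V = "fv l \<inter> dom \<gamma>"
  have fin: "finite ?V" by (simp add: finite_fv)
  have "fv l \<subseteq> {..<b + 7 + 0}" "?V \<subseteq> {..<b}" using assms(3) by auto
  then have "\<exists>w. (\<forall>x\<in>?V. col (w x) (the (\<gamma> x))) \<and> sat n I C (\<lambda>v. if v \<in> ?V then w v else e v) l"
    using assms(4) sat_guard[OF assms(2), of "sorted_list_of_set ?V" b l 0 I C e \<gamma>] False assms(1) fin
    by (simp add: weak_lit_guard col_def)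
  then obtain w where w: "\<And>x. x \<in> ?V \<Longrightarrow> col (w x) (the (\<gamma> x))"
      "sat n I C (\<lambda>v. if v \<in> ?V then w v else e v) l"
    by blast
  obtain c where c: "\<And>x i. \<gamma> x = Some i \<Longrightarrow> col (c x) i"
    using inhabitedE[OF assms(6)] by blast
  define u where "u = (\<lambda>x. if x \<in> ?V then w x else c x)"
  have rel: "has_relevant_lit x l" if "x \<in> fv l" for x
    using that has_relevant_lit_lit[OF assms(1)] False by (auto simp: is_neq_lit_def)
  have "weak_witness n I C e col \<gamma> l u"
    unfolding weak_witness_def
  proof (intro conjI allI impI)
    fix x i assume "\<gamma> x = Some i"
    then show "col (u x) i" using w(1)[of x] c[of x i] by (auto simp: u_def)
  next
    fix a assume a: "coloured_ext col \<gamma> (\<lambda>x. has_relevant_lit x l) u a"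
    have "sat n I C (override e \<gamma> a) l \<longleftrightarrow> sat n I C (\<lambda>v. if v \<in> ?V then w v else e v) l"
      by (rule sat_cong) (use a rel in \<open>auto simp: override_def coloured_ext_def u_def\<close>)
    with w(2) show "sat n I C (override e \<gamma> a) l" by simp
  qed
  then show ?thesis by blast
qed

lemma override_empty [simp]: "override e Map.empty a = e"
  by (simp add: override_def)

lemma weak_witness_All:
  assumes "\<forall>x\<in>dom \<gamma>. \<not> strong_ex x (All y \<phi>)" "inhabited col \<gamma>" "sat n I C e (All y \<phi>)"
  shows "\<exists>w. weak_witness n I C e col \<gamma> (All y \<phi>) w"
proof -
  obtain c where c: "\<And>x i. \<gamma> x = Some i \<Longrightarrow> col (c x) i"
    using inhabitedE[OF assms(2)] by blast
  have "sat n I C (override e \<gamma> a) (All y \<phi>) \<longleftrightarrow> sat n I C e (All y \<phi>)" for a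
    by (rule sat_cong) (use assms(1) weak_All in \<open>fastforce simp: override_def\<close>)
  then have "weak_witness n I C e col \<gamma> (All y \<phi>) c"
    using c assms(3) by (simp only: weak_witness_def) simp
  then show ?thesis by blast
qed

text \<open>The parameters are whatever \<open>e\<close> assigns to b and b + 1: only nonempty
  classes are required, and each weak quantifier brings its own test for that. So this direction
  holds in every universe, however small.\<close>

lemma remove_weak_sound:
  fixes \<phi> :: "('r, 'c) fm"
  assumes "nnf \<phi>" "0 < n" "fv \<phi> \<union> bound \<phi> \<subseteq> {..<b}" "\<forall>x\<in>dom \<gamma>. \<not> strong_ex x \<phi>"
    "inhabited (\<lambda>v i. v < n \<and> has_colour n (e b) (e (b + 1)) v i) \<gamma>"
    "sat n I C e (remove_weak b \<gamma> i \<phi>)"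
  shows "\<exists>w. weak_witness n I C e (\<lambda>v i. v < n \<and> has_colour n (e b) (e (b + 1)) v i) \<gamma> \<phi> w"
  using assms(1,3-)
proof (induction \<phi> arbitrary: \<gamma> e i rule: nnf_induct)
  case (Lit l)
  then show ?case
    using weak_lit_sound[OF Lit.hyps assms(2)] by (simp add: remove_weak_lit)
next
  case (Conj \<phi> \<psi>)
  let ?col = "\<lambda>v i. v < n \<and> has_colour n (e b) (e (b + 1)) v i"
  have weak: "\<forall>x\<in>dom \<gamma>. \<not> strong_ex x \<phi>" "\<forall>x\<in>dom \<gamma>. \<not> strong_ex x \<psi>"
      "\<forall>x\<in>dom \<gamma>. \<not> (has_relevant_lit x \<phi> \<and> has_relevant_lit x \<psi>)"
    using Conj.prems(2) weak_Conj by blast+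
  obtain w w' where w: "weak_witness n I C e ?col \<gamma> \<phi> w" "weak_witness n I C e ?col \<gamma> \<psi> w'"
    using Conj.IH(1)[of \<gamma> e i] Conj.IH(2)[of \<gamma> e "i + num_ex \<phi>"] Conj.prems weak by auto
  define u where "u = (\<lambda>x. if has_relevant_lit x \<phi> then w x else w' x)"
  have "u x = w x" if "has_relevant_lit x \<phi>" for x
    using that by (simp add: u_def)
  moreover have "u x = w' x" if "\<gamma> x = Some j" "has_relevant_lit x \<psi>" for x j
    using that weak(3) by (auto simp: u_def)
  moreover have "?col (u x) j" if "\<gamma> x = Some j" for x j
    using that w by (simp add: u_def weak_witness_def)
  ultimately have "weak_witness n I C e ?col \<gamma> (Conj \<phi> \<psi>) u"
    using w unfolding weak_witness_def coloured_ext_def by simp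
  then show ?case by blast
next
  case (Disj \<phi> \<psi>)
  let ?col = "\<lambda>v i. v < n \<and> has_colour n (e b) (e (b + 1)) v i"
  have weak: "\<forall>x\<in>dom \<gamma>. \<not> strong_ex x \<phi>" "\<forall>x\<in>dom \<gamma>. \<not> strong_ex x \<psi>"
    using Disj.prems(2) weak_Disj by blast+
  have "\<exists>w. weak_witness n I C e ?col \<gamma> \<phi> w \<or> weak_witness n I C e ?col \<gamma> \<psi> w"
    using Disj.IH(1)[of \<gamma> e i] Disj.IH(2)[of \<gamma> e "i + num_ex \<phi>"] Disj.prems weak by auto
  then obtain w where "weak_witness n I C e ?col \<gamma> \<phi> w \<or> weak_witness n I C e ?col \<gamma> \<psi> w" ..
  then have "weak_witness n I C e ?col \<gamma> (Disj \<phi> \<psi>) w"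
    unfolding weak_witness_def coloured_ext_def by auto
  then show ?case by blast
next
  case (Ex x \<phi>)
  let ?col = "\<lambda>v i. v < n \<and> has_colour n (e b) (e (b + 1)) v i"
  obtain c where c: "\<And>y j. \<gamma> y = Some j \<Longrightarrow> ?col (c y) j"
    using inhabitedE[OF Ex.prems(3)] by blast
  have weak: "\<forall>y\<in>dom \<gamma> - {x}. \<not> strong_ex y \<phi>"
    using Ex.prems(2) weak_Ex by blast
  have b: "fv \<phi> \<union> bound \<phi> \<subseteq> {..<b}" "x < b"
    using Ex.prems(1) by auto
  show ?case
  proof (cases "strong_ex x \<phi>")
    case True
    let ?\<gamma> = "\<gamma>(x := None)"
    obtain d where d: "d < n" "sat n I C (e(x := d)) (remove_weak b ?\<gamma> (Suc i) \<phi>)"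
      using Ex.prems(4) True by auto
    have "\<exists>w. weak_witness n I C (e(x := d))
        (\<lambda>v i. v < n \<and> has_colour n ((e(x := d)) b) ((e(x := d)) (b + 1)) v i) ?\<gamma> \<phi> w"
      using Ex.prems(3) weak b by (intro Ex.IH[OF _ _ _ d(2)]) (auto simp: inhabited_def split: if_splits)
    then obtain w where w: "weak_witness n I C (e(x := d)) ?col ?\<gamma> \<phi> w"
      using b by auto
    \<comment> \<open>An outer weak variable of the same name x may be shadowed here. It is not
      relevant in \<open>Ex x \<phi>\<close>, but still needs a value of its own class, which
      \<open>c\<close> supplies.\<close>
    have "weak_witness n I C e ?col \<gamma> (Ex x \<phi>) (w(x := c x))"
      unfolding weak_witness_def
    proof (rule conjI; intro allI impI)
      show "?col ((w(x := c x)) y) j" if "\<gamma> y = Some j" for y j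
        using that c w unfolding weak_witness_def by (cases "y = x") auto
    next
      fix a assume a: "coloured_ext ?col \<gamma> (\<lambda>y. has_relevant_lit y (Ex x \<phi>)) (w(x := c x)) a"
      then have "coloured_ext ?col ?\<gamma> (\<lambda>y. has_relevant_lit y \<phi>) w a"
        unfolding coloured_ext_def by (auto split: if_splits)
      then have "sat n I C (override (e(x := d)) ?\<gamma> a) \<phi>"
        using w unfolding weak_witness_def by blast
      moreover have "override (e(x := d)) ?\<gamma> a = (override e \<gamma> a)(x := d)"
        by (auto simp: override_def)
      ultimately show "sat n I C (override e \<gamma> a) (Ex x \<phi>)"
        using d(1) by (simp only: sat.simps) blast
    qed
    then show ?thesis by blast
  next
    case False
    let ?\<gamma> = "\<gamma>(x \<mapsto> i)"
    have "sat n I C e (Ex (b + 6) (colour_fm b (b + 6) i))"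
      using Ex.prems(4) False by simp
    then obtain v where v: "?col v i"
      by (auto simp: sat_colour_fm[OF assms(2)])
    have sat: "sat n I C e (remove_weak b ?\<gamma> (Suc i) \<phi>)"
      using Ex.prems(4) False by simp
    have "\<forall>y\<in>dom ?\<gamma>. \<not> strong_ex y \<phi>"
      using weak False by auto
    moreover have "inhabited ?col ?\<gamma>"
      using Ex.prems(3) v unfolding inhabited_def fun_upd_apply by (metis option.inject)
    ultimately obtain w where w: "weak_witness n I C e ?col ?\<gamma> \<phi> w"
      using Ex.IH[OF b(1) _ _ sat] by blast
    have "weak_witness n I C e ?col \<gamma> (Ex x \<phi>) (w(x := c x))"
      unfolding weak_witness_def
    proof (rule conjI; intro allI impI)
      show "?col ((w(x := c x)) y) j" if "\<gamma> y = Some j" for y j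
        using that c w unfolding weak_witness_def by (cases "y = x") auto
    next
      fix a assume a: "coloured_ext ?col \<gamma> (\<lambda>y. has_relevant_lit y (Ex x \<phi>)) (w(x := c x)) a"
      have wx: "?col (w x) i" using w unfolding weak_witness_def by simp
      \<comment> \<open>The inner x is always given the value \<open>w x\<close>, whatever
        \<open>a\<close> assigns to a shadowed x.\<close>
      have "coloured_ext ?col ?\<gamma> (\<lambda>y. has_relevant_lit y \<phi>) w (a(x := w x))"
        using a wx unfolding coloured_ext_def by (auto split: if_splits)
      then have "sat n I C (override e ?\<gamma> (a(x := w x))) \<phi>"
        using w unfolding weak_witness_def by blast
      moreover have "override e ?\<gamma> (a(x := w x)) = (override e \<gamma> a)(x := w x)"
        by (auto simp: override_def)
      ultimately show "sat n I C (override e \<gamma> a) (Ex x \<phi>)"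
        using wx by (simp only: sat.simps) blast
    qed
    then show ?thesis by blast
  qed
next
  case (All x \<phi>)
  have b: "fv \<phi> \<union> bound \<phi> \<subseteq> {..<b}" "x < b"
    using All.prems(1) by auto
  have "sat n I C (e(x := d)) \<phi>" if d: "d < n" for d
  proof -
    obtain p q where s: "sat n I C (e(x := d, b := p, b + 1 := q)) (remove_weak b Map.empty 0 \<phi>)"
      using All.prems(4) d by auto
    have "\<exists>w. weak_witness n I C (e(x := d, b := p, b + 1 := q))
        (\<lambda>v i. v < n \<and> has_colour n ((e(x := d, b := p, b + 1 := q)) b)
          ((e(x := d, b := p, b + 1 := q)) (b + 1)) v i) Map.empty \<phi> w"
      by (rule All.IH[OF b(1) _ _ s]) (auto simp: inhabited_def)
    then have "sat n I C (e(x := d, b := p, b + 1 := q)) \<phi>"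
      by (simp add: weak_witness_def coloured_ext_def)
    also have "sat n I C (e(x := d, b := p, b + 1 := q)) \<phi> \<longleftrightarrow> sat n I C (e(x := d)) \<phi>"
      by (rule sat_cong) (use b in auto)
    finally show ?thesis .
  qed
  then show ?case
    by (intro weak_witness_All All.prems(2,3)) simp
qed


section \<open>Completeness of the translation in large universes\<close>

text \<open>D lists, by index, the witnesses of the existential quantifiers. The translation is
  evaluated under \<open>e'\<close>, which holds the parameters p and q and is arbitrary on weak variables.\<close>

definition transfers ::
  "nat \<Rightarrow> ('r \<Rightarrow> nat list \<Rightarrow> bool) \<Rightarrow> ('c \<Rightarrow> nat) \<Rightarrow> (nat \<Rightarrow> nat) \<Rightarrow> nat \<Rightarrow> nat \<Rightarrow>
   (nat \<Rightarrow> nat option) \<Rightarrow> nat \<Rightarrow> ('r, 'c) fm \<Rightarrow> (nat \<Rightarrow> nat) \<Rightarrow> bool" where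
  "transfers n I C e b k \<gamma> i \<phi> D \<longleftrightarrow>
     (\<forall>V e'. (\<forall>j. D j < n) \<longrightarrow> (\<forall>x j. \<gamma> x = Some j \<longrightarrow> j < k \<and> D j = e x) \<longrightarrow>
        (\<forall>x\<in>fv \<phi>. e x \<in> V \<union> D ` {..<k}) \<longrightarrow> (\<forall>x\<in>fv \<phi>. \<gamma> x = None \<longrightarrow> e' x = e x) \<longrightarrow>
        separates n k (e' b) (e' (b + 1)) D V \<longrightarrow> sat n I C e' (remove_weak b \<gamma> i \<phi>))"

lemma weak_lit_complete:
  fixes l :: "('r, 'c) fm"
  assumes "is_lit l" "0 < n" "fv l \<subseteq> {..<b}" "sat n I C e l"
    "\<forall>j. D j < n" "\<And>x j. \<gamma> x = Some j \<Longrightarrow> j < k \<and> D j = e x"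
    "\<forall>x\<in>fv l. e x \<in> V \<union> D ` {..<k}" "\<forall>x\<in>fv l. \<gamma> x = None \<longrightarrow> e' x = e x"
    "separates n k (e' b) (e' (b + 1)) D V"
  shows "sat n I C e' (weak_lit b \<gamma> l)"
proof (cases "\<exists>x y. l = Neg (Eq (Var x) (Var y))")
  case True
  then obtain x y where l: "l = Neg (Eq (Var x) (Var y))" by blast
  have sc: "sat n I C e' (colour_fm b v i) \<longleftrightarrow> has_colour n (e' b) (e' (b + 1)) (e' v) i"
    if "v < b \<or> v = b + 6" for e' v i
    using that by (intro sat_colour_fm assms(2)) auto
  have xy: "x < b" "y < b" "e x \<noteq> e y" "e x \<in> V \<union> D ` {..<k}" "e y \<in> V \<union> D ` {..<k}"
      "\<gamma> x = None \<Longrightarrow> e' x = e x" "\<gamma> y = None \<Longrightarrow> e' y = e y"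
    using assms(3,4,7,8) l by auto
  have sep: "\<not> has_colour n (e' b) (e' (b + 1)) v j"
    if "\<gamma> z = Some j" "v \<in> V \<union> D ` {..<k}" "v \<noteq> e z" for v z j
    using that assms(6)[OF that(1)] assms(9) unfolding separates_def by metis
  show ?thesis
  proof (cases "\<gamma> x")
    case None
    then show ?thesis
      using xy sep[of y _ "e x"] by (auto simp: l weak_lit_neq sc split: option.splits)
  next
    case x: (Some i)
    show ?thesis
    proof (cases "\<gamma> y")
      case None
      then show ?thesis
        using xy x sep[of x _ "e y"] by (auto simp: l weak_lit_neq sc split: option.splits)
    next
      case y: (Some j)
      have "D i \<noteq> D j" "i < k" "j < k" using assms(6) x y xy(3) by auto
      then have "\<not> (has_colour n (e' b) (e' (b + 1)) v i \<and> has_colour n (e' b) (e' (b + 1)) v j)"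
        if "v < n" for v
        using that assms(9) unfolding separates_def by metis
      then show ?thesis by (simp add: l weak_lit_neq sc x y)
    qed
  qed
next
  case False
  let ?V = "fv l \<inter> dom \<gamma>"
  have fin: "finite ?V" by (simp add: finite_fv)
  have V: "fv l \<subseteq> {..<b + 7 + 0}" "?V \<subseteq> {..<b}" using assms(3) by auto
  have "e x < n \<and> has_colour n (e' b) (e' (b + 1)) (e x) (the (\<gamma> x))" if "x \<in> ?V" for x
  proof -
    from that obtain j where "\<gamma> x = Some j" by auto
    with assms(5,9) assms(6)[OF this] show ?thesis
      unfolding separates_def by (metis option.sel)
  qed
  moreover have "sat n I C (\<lambda>v. if v \<in> ?V then e v else e' v) l \<longleftrightarrow> sat n I C e l"
    by (rule sat_cong) (use assms(8) in auto)
  ultimately have "\<exists>a. (\<forall>x\<in>?V. a x < n \<and> has_colour n (e' b) (e' (b + 1)) (a x) (the (\<gamma> x))) \<and>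
      sat n I C (\<lambda>v. if v \<in> ?V then a v else e' v) l"
    using assms(4) by blast
  then show ?thesis
    using sat_guard[OF assms(2), of "sorted_list_of_set ?V" b l 0 I C e' \<gamma>] False assms(1) V fin
    by (simp add: weak_lit_guard)
qed

text \<open>The witnesses are collected in \<open>D\<close> before the parameters are chosen, which
  is why \<open>transfers\<close> quantifies over \<open>e'\<close> afterwards. Only the values of
  \<open>D\<close> on the formula's own index interval matter, so the lists for the two sides of a
  conjunction, which use disjoint intervals, can be merged. Each value of a universal variable gets
  its own \<open>D\<close>, and \<open>hash\<close> then yields its own p and q.\<close>

lemma remove_weak_complete:
  fixes \<phi> :: "('r, 'c) fm"
  assumes "nnf \<phi>" "0 < n" "fv \<phi> \<union> bound \<phi> \<subseteq> {..<b}" "\<forall>x\<in>dom \<gamma>. \<not> strong_ex x \<phi>"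
    and hash: "\<And>D V. (\<forall>j. D j < n) \<Longrightarrow> V \<subseteq> {..<n} \<Longrightarrow> finite V \<Longrightarrow> card V \<le> b \<Longrightarrow>
        \<exists>p<n. \<exists>q<n. separates n k p q D V"
    and "i + num_ex \<phi> \<le> k" "\<forall>v. e v < n" "sat n I C e \<phi>"
  shows "\<exists>D. (\<forall>j. D j < n) \<and>
     (\<forall>D'. (\<forall>j\<in>{i..<i + num_ex \<phi>}. D' j = D j) \<longrightarrow> transfers n I C e b k \<gamma> i \<phi> D')"
  using assms(1,3,4,6-)
proof (induction \<phi> arbitrary: \<gamma> e i rule: nnf_induct)
  case (Lit l)
  have "transfers n I C e b k \<gamma> i l D" for D
    unfolding transfers_def remove_weak_lit[OF Lit.hyps]
    using weak_lit_complete[OF Lit.hyps assms(2) _ Lit.prems(5)] Lit.prems(1) by blast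
  then show ?case using assms(2) by (intro exI[of _ "\<lambda>_. 0"]) simp
next
  case (Conj \<phi> \<psi>)
  have weak: "\<forall>x\<in>dom \<gamma>. \<not> strong_ex x \<phi>" "\<forall>x\<in>dom \<gamma>. \<not> strong_ex x \<psi>"
    using Conj.prems(2) weak_Conj by blast+
  let ?i = "i + num_ex \<phi>"
  obtain D1 where D1: "\<forall>j. D1 j < n"
      "\<And>D'. (\<forall>j\<in>{i..<?i}. D' j = D1 j) \<Longrightarrow> transfers n I C e b k \<gamma> i \<phi> D'"
    using Conj.IH(1)[of \<gamma> i e] Conj.prems weak by auto
  obtain D2 where D2: "\<forall>j. D2 j < n"
      "\<And>D'. (\<forall>j\<in>{?i..<?i + num_ex \<psi>}. D' j = D2 j) \<Longrightarrow> transfers n I C e b k \<gamma> ?i \<psi> D'"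
    using Conj.IH(2)[of \<gamma> ?i e] Conj.prems weak by auto
  have "transfers n I C e b k \<gamma> i (Conj \<phi> \<psi>) D'"
    if "\<forall>j\<in>{i..<i + num_ex (Conj \<phi> \<psi>)}. D' j = (if j < ?i then D1 j else D2 j)" for D'
  proof -
    have "transfers n I C e b k \<gamma> i \<phi> D'" "transfers n I C e b k \<gamma> ?i \<psi> D'"
      using that by (auto intro!: D1(2) D2(2))
    then show ?thesis
      unfolding transfers_def remove_weak.simps sat.simps fv.simps ball_Un by blast
  qed
  moreover have "\<forall>j. (if j < ?i then D1 j else D2 j) < n" using D1(1) D2(1) by simp
  ultimately show ?case by (intro exI[of _ "\<lambda>j. if j < ?i then D1 j else D2 j"]) blast
next
  case (Disj \<phi> \<psi>)
  have weak: "\<forall>x\<in>dom \<gamma>. \<not> strong_ex x \<phi>" "\<forall>x\<in>dom \<gamma>. \<not> strong_ex x \<psi>"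
    using Disj.prems(2) weak_Disj by blast+
  let ?i = "i + num_ex \<phi>"
  show ?case
  proof (cases "sat n I C e \<phi>")
    case True
    then obtain D where D: "\<forall>j. D j < n"
        "\<And>D'. (\<forall>j\<in>{i..<?i}. D' j = D j) \<Longrightarrow> transfers n I C e b k \<gamma> i \<phi> D'"
      using Disj.IH(1)[of \<gamma> i e] Disj.prems weak by auto
    have "transfers n I C e b k \<gamma> i (Disj \<phi> \<psi>) D'"
      if "\<forall>j\<in>{i..<i + num_ex (Disj \<phi> \<psi>)}. D' j = D j" for D'
    proof -
      have "transfers n I C e b k \<gamma> i \<phi> D'"
        using that by (auto intro!: D(2))
      then show ?thesis
        unfolding transfers_def remove_weak.simps sat.simps fv.simps ball_Un by blast
    qed
    with D(1) show ?thesis by blast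
  next
    case False
    then obtain D where D: "\<forall>j. D j < n"
        "\<And>D'. (\<forall>j\<in>{?i..<?i + num_ex \<psi>}. D' j = D j) \<Longrightarrow> transfers n I C e b k \<gamma> ?i \<psi> D'"
      using Disj.IH(2)[of \<gamma> ?i e] Disj.prems weak by auto
    have "transfers n I C e b k \<gamma> i (Disj \<phi> \<psi>) D'"
      if "\<forall>j\<in>{i..<i + num_ex (Disj \<phi> \<psi>)}. D' j = D j" for D'
    proof -
      have "transfers n I C e b k \<gamma> ?i \<psi> D'"
        using that by (auto intro!: D(2))
      then show ?thesis
        unfolding transfers_def remove_weak.simps sat.simps fv.simps ball_Un by blast
    qed
    with D(1) show ?thesis by blast
  qed
next
  case (Ex x \<phi>)
  have weak: "\<forall>y\<in>dom \<gamma> - {x}. \<not> strong_ex y \<phi>"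
    using Ex.prems(2) weak_Ex by blast
  have b: "fv \<phi> \<union> bound \<phi> \<subseteq> {..<b}" "x < b"
    using Ex.prems(1) by auto
  obtain d where d: "d < n" "sat n I C (e(x := d)) \<phi>"
    using Ex.prems(5) by auto
  have e: "\<forall>v. (e(x := d)) v < n"
    using Ex.prems(4) d(1) by simp
  let ?\<gamma> = "if strong_ex x \<phi> then \<gamma>(x := None) else \<gamma>(x \<mapsto> i)"
  have "\<forall>y\<in>dom ?\<gamma>. \<not> strong_ex y \<phi>"
    using weak by (auto split: if_splits)
  then have "\<exists>D. (\<forall>j. D j < n) \<and> (\<forall>D'. (\<forall>j\<in>{Suc i..<Suc i + num_ex \<phi>}. D' j = D j) \<longrightarrow>
      transfers n I C (e(x := d)) b k ?\<gamma> (Suc i) \<phi> D')"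
    by (rule Ex.IH[OF b(1)]) (use Ex.prems(3) d(2) e in \<open>simp_all del: fun_upd_apply\<close>)
  then obtain D where D: "\<forall>j. D j < n"
      "\<And>D'. (\<forall>j\<in>{Suc i..<Suc i + num_ex \<phi>}. D' j = D j) \<Longrightarrow>
         transfers n I C (e(x := d)) b k ?\<gamma> (Suc i) \<phi> D'"
    by blast
  have "transfers n I C e b k \<gamma> i (Ex x \<phi>) D'"
    if D': "\<forall>j\<in>{i..<i + num_ex (Ex x \<phi>)}. D' j = (D(i := d)) j" for D'
    unfolding transfers_def
  proof (intro allI impI)
    fix V e'
    assume a: "\<forall>j. D' j < n" "\<forall>y j. \<gamma> y = Some j \<longrightarrow> j < k \<and> D' j = e y"
      "\<forall>y\<in>fv (Ex x \<phi>). e y \<in> V \<union> D' ` {..<k}" "\<forall>y\<in>fv (Ex x \<phi>). \<gamma> y = None \<longrightarrow> e' y = e y"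
      "separates n k (e' b) (e' (b + 1)) D' V"
    have i: "i < k" "D' i = d" using Ex.prems(3) D' by auto
    have T: "transfers n I C (e(x := d)) b k ?\<gamma> (Suc i) \<phi> D'"
      using D' by (intro D(2)) auto
    \<comment> \<open>The new value \<open>d\<close> of x is covered because it is the entry of
      \<open>D'\<close> at index \<open>i\<close>; this applies to strong quantifiers as
      well.\<close>
    have *: "\<forall>y\<in>fv \<phi>. (e(x := d)) y \<in> V \<union> D' ` {..<k}"
      using a(3) i by auto
    show "sat n I C e' (remove_weak b \<gamma> i (Ex x \<phi>))"
    proof (cases "strong_ex x \<phi>")
      case True
      have "sat n I C (e'(x := d)) (remove_weak b ?\<gamma> (Suc i) \<phi>)"
        by (rule T[unfolded transfers_def, rule_format, of V])
          (use a * True b in \<open>auto split: if_splits\<close>)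
      then show ?thesis using True d(1) by auto
    next
      case False
      have "sat n I C e' (remove_weak b ?\<gamma> (Suc i) \<phi>)"
        by (rule T[unfolded transfers_def, rule_format, of V])
          (use a * False b i in \<open>auto split: if_splits\<close>)
      moreover have "has_colour n (e' b) (e' (b + 1)) d i"
        using a(5) i unfolding separates_def by metis
      ultimately show ?thesis
        using False d(1) by (auto simp: sat_colour_fm[OF assms(2)])
    qed
  qed
  moreover have "\<forall>j. (D(i := d)) j < n" using D(1) d(1) by simp
  ultimately show ?case by blast
next
  case (All x \<phi>)
  have b: "fv \<phi> \<union> bound \<phi> \<subseteq> {..<b}" "x < b"
    using All.prems(1) by auto
  have "transfers n I C e b k \<gamma> i (All x \<phi>) D'" for D'
    unfolding transfers_def
  proof (intro allI impI)
    fix V e'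
    assume e': "\<forall>y\<in>fv (All x \<phi>). \<gamma> y = None \<longrightarrow> e' y = e y"
    have "\<exists>p<n. \<exists>q<n. sat n I C (e'(x := d, b := p, b + 1 := q)) (remove_weak b Map.empty 0 \<phi>)"
      if d: "d < n" for d
    proof -
      let ?e = "e(x := d)"
      \<comment> \<open>These are the values of all variables that may be free in
        \<open>\<phi>\<close>; there are at most b of them whatever the size of the
        universe.\<close>
      let ?V = "?e ` {..<b}"
      have e: "\<forall>v. ?e v < n" using All.prems(4) d by simp
      have sat: "sat n I C ?e \<phi>" using All.prems(5) d by simp
      have "\<exists>D. (\<forall>j. D j < n) \<and> (\<forall>D'. (\<forall>j\<in>{0..<0 + num_ex \<phi>}. D' j = D j) \<longrightarrow>
          transfers n I C ?e b k Map.empty 0 \<phi> D')"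
        by (rule All.IH[OF b(1) _ _ e sat]) (use All.prems(3) in auto)
      then obtain D where D: "\<forall>j. D j < n" "transfers n I C ?e b k Map.empty 0 \<phi> D"
        by blast
      have "card ?V \<le> b" using card_image_le[of "{..<b}" ?e] by simp
      then obtain p q where pq: "p < n" "q < n" "separates n k p q D ?V"
        using hash[OF D(1), of ?V] e by blast
      have "sat n I C (e'(x := d, b := p, b + 1 := q)) (remove_weak b Map.empty 0 \<phi>)"
      proof (rule D(2)[unfolded transfers_def, rule_format, of ?V])
        \<comment> \<open>A free variable other than x is free in \<open>All x \<phi>\<close>, hence
          not weak, so \<open>e'\<close> agrees with \<open>e\<close> on it.\<close>
        show "(e'(x := d, b := p, b + 1 := q)) y = ?e y" if "y \<in> fv \<phi>" for y
          using that b e' All.prems(2) weak_All[of _ x \<phi>] by fastforce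
      qed (use b D(1) pq in auto)
      with pq show ?thesis by blast
    qed
    then show "sat n I C e' (remove_weak b \<gamma> i (All x \<phi>))" by simp
  qed
  then show ?case using assms(2) by (intro exI[of _ "\<lambda>_. 0"]) simp
qed

section \<open>Assembling the equivalent formula\<close>

text \<open>The threshold depends only on b and on the number of existential quantifiers. The
  outermost pair p, q is the one not charged to a universal quantifier; it adds 2 to the
  rank.\<close>

lemma remove_weak_equiv:
  fixes \<phi> :: "('r, 'c) fm"
  assumes "nnf \<phi>" "fv \<phi> \<union> bound \<phi> \<subseteq> {..<b}"
  shows "\<exists>N. \<forall>n>N. equiv_at n Cs \<phi> (Ex b (Ex (b + 1) (remove_weak b Map.empty 0 \<phi>)))"
proof -
  define k where "k = num_ex \<phi>"
  obtain n0 where n0: "\<forall>n\<ge>n0. \<forall>D V. (\<forall>j. D j < n) \<longrightarrow> V \<subseteq> {..<n} \<longrightarrow> finite V \<longrightarrow> card V \<le> b \<longrightarrow>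
     (\<exists>p<n. \<exists>q<n. separates n k p q D V)"
    using ex_separates by blast
  have "equiv_at n Cs \<phi> (Ex b (Ex (b + 1) (remove_weak b Map.empty 0 \<phi>)))" if n: "n > n0" for n
    unfolding equiv_at_def
  proof (intro allI impI iffI)
    fix I :: "'r \<Rightarrow> nat list \<Rightarrow> bool" and C :: "'c \<Rightarrow> nat" and e :: "nat \<Rightarrow> nat"
    have pos: "0 < n" using n by simp
    {
      assume e: "\<forall>v. e v < n" and "sat n I C e \<phi>"
      let ?V = "e ` {..<b}"
      obtain D where D: "\<forall>j. D j < n" "transfers n I C e b k Map.empty 0 \<phi> D"
        using remove_weak_complete[OF assms(1) pos assms(2), of Map.empty k 0 e I C] n0 n e
          \<open>sat n I C e \<phi>\<close> by (auto simp: k_def)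
      have "card ?V \<le> b" using card_image_le[of "{..<b}" e] by simp
      then obtain p q where pq: "p < n" "q < n" "separates n k p q D ?V"
        using n0[rule_format, of n D ?V] D(1) n e by auto
      have "sat n I C (e(b := p, b + 1 := q)) (remove_weak b Map.empty 0 \<phi>)"
        by (rule D(2)[unfolded transfers_def, rule_format, of ?V]) (use assms(2) D(1) pq in auto)
      with pq show "sat n I C e (Ex b (Ex (b + 1) (remove_weak b Map.empty 0 \<phi>)))" by auto
    next
      assume "sat n I C e (Ex b (Ex (b + 1) (remove_weak b Map.empty 0 \<phi>)))"
      then obtain p q where "sat n I C (e(b := p, b + 1 := q)) (remove_weak b Map.empty 0 \<phi>)"
        by auto
      then have "sat n I C (e(b := p, b + 1 := q)) \<phi>"
        using remove_weak_sound[OF assms(1) pos assms(2), of Map.empty "e(b := p, b + 1 := q)" I C 0]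
        by (auto simp: inhabited_def weak_witness_def coloured_ext_def)
      also have "sat n I C (e(b := p, b + 1 := q)) \<phi> \<longleftrightarrow> sat n I C e \<phi>"
        by (rule sat_cong) (use assms(2) in auto)
      finally show "sat n I C e \<phi>" .
    }
  qed
  then show ?thesis by blast
qed

text \<open>Padding for the lower estimate of the rank: a strong existential quantifier contributes
  only one, so the translation alone can have rank far below three times the strong rank.\<close>

lemma ex_true:
  "\<exists>\<pi>::('r, 'c) fm. wf_fm R ar Cs \<pi> \<and> qr \<pi> = m \<and> bound \<pi> \<subseteq> {b} \<and>
     (\<forall>n I C e. 0 < n \<longrightarrow> sat n I C e \<pi>)"
proof (induction m)
  case 0
  show ?case by (intro exI[of _ "Eq Zero Zero"]) simp
next
  case (Suc m)
  then obtain \<pi> :: "('r, 'c) fm" where "wf_fm R ar Cs \<pi>" "qr \<pi> = m" "bound \<pi> \<subseteq> {b}"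
      "\<forall>n I C e. 0 < n \<longrightarrow> sat n I C e \<pi>"
    by blast
  then show ?case by (intro exI[of _ "Ex b \<pi>"]) auto
qed

theorem theorem3p5:
  shows "\<exists>c::nat. \<forall>(R::'r set) (ar::'r \<Rightarrow> nat) (Cs::'c set) (\<phi>::('r, 'c) fm).
     finite R \<longrightarrow> finite Cs \<longrightarrow> nnf \<phi> \<longrightarrow> wf_fm R ar Cs \<phi> \<longrightarrow>
     (\<exists>\<phi>'. wf_fm R ar Cs \<phi>' \<and> equiv_fin Cs \<phi> \<phi>' \<and>
        \<bar>int (qr \<phi>') - 3 * int (strong_qr \<phi>)\<bar> \<le> int (c * sig_arity R ar + c) \<and>
        \<bar>int (card (bound \<phi>')) - int (card (strong_bound \<phi>))\<bar> \<le> int (c * sig_arity R ar + c))"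
\<comment> \<open>Both estimates have the additive term 7: the rank picks up 5 inside the
  translation and 2 for the outermost parameters, and b, ..., b + 6 are the seven fixed auxiliary
  variables.\<close>
proof (intro exI[of _ 7] allI impI)
  fix R :: "'r set" and ar and Cs :: "'c set" and \<phi> :: "('r, 'c) fm"
  assume fin: "finite R" and nnf: "nnf \<phi>" and wf: "wf_fm R ar Cs \<phi>"
  let ?A = "sig_arity R ar"
  obtain b where b: "fv \<phi> \<union> bound \<phi> \<subseteq> {..<b}"
    using finite_nat_set_iff_bounded[of "fv \<phi> \<union> bound \<phi>"] finite_fv[of \<phi>] finite_bound[of \<phi>] by auto
  let ?\<psi> = "remove_weak b Map.empty 0 \<phi>"
  obtain \<pi> :: "('r, 'c) fm" where \<pi>: "wf_fm R ar Cs \<pi>" "qr \<pi> = 3 * strong_qr \<phi>" "bound \<pi> \<subseteq> {b}"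
      "\<forall>n I C e. 0 < n \<longrightarrow> sat n I C e \<pi>"
    using ex_true by blast
  let ?\<chi> = "Conj \<pi> (Ex b (Ex (b + 1) ?\<psi>))"
  obtain N where N: "\<forall>n>N. equiv_at n Cs \<phi> (Ex b (Ex (b + 1) ?\<psi>))"
    using remove_weak_equiv[OF nnf b] by blast
  have equiv: "equiv_at n Cs \<phi> ?\<chi>" if "N < n" for n
    using N that \<pi>(4) unfolding equiv_at_def by simp
  note bnd = remove_weak_bounds[OF nnf wf fin, of b Map.empty 0]
  then have "wf_fm R ar Cs ?\<chi>" using \<pi>(1) by simp
  from equiv_finI_large[OF nnf wf this equiv]
  obtain \<phi>' where \<phi>': "wf_fm R ar Cs \<phi>'" "qr \<phi>' = qr ?\<chi>" "bound \<phi>' = bound ?\<chi>" "equiv_fin Cs \<phi> \<phi>'"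
    by auto
  have qr: "3 * strong_qr \<phi> \<le> qr \<phi>'" "qr \<phi>' \<le> 3 * strong_qr \<phi> + ?A + 7"
    using \<phi>'(2) \<pi>(2) bnd by auto
  have "strong_bound \<phi> \<subseteq> bound \<phi>'"
    using \<phi>'(3) bnd by auto
  then have "card (strong_bound \<phi>) \<le> card (bound \<phi>')"
    by (rule card_mono[OF finite_bound])
  moreover have "bound \<phi>' \<subseteq> strong_bound \<phi> \<union> {b..<b + 7 + ?A}"
    using \<phi>'(3) \<pi>(3) bnd by auto
  then have "card (bound \<phi>') \<le> card (strong_bound \<phi> \<union> {b..<b + 7 + ?A})"
    by (intro card_mono) (simp_all add: finite_strong_bound)
  then have "card (bound \<phi>') \<le> card (strong_bound \<phi>) + (7 + ?A)"
    using card_Un_le[of "strong_bound \<phi>" "{b..<b + 7 + ?A}"] by simp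
  ultimately show "\<exists>\<phi>'. wf_fm R ar Cs \<phi>' \<and> equiv_fin Cs \<phi> \<phi>' \<and>
        \<bar>int (qr \<phi>') - 3 * int (strong_qr \<phi>)\<bar> \<le> int (7 * ?A + 7) \<and>
        \<bar>int (card (bound \<phi>')) - int (card (strong_bound \<phi>))\<bar> \<le> int (7 * ?A + 7)"
    using \<phi>'(1,4) qr by (intro exI[of _ \<phi>'] conjI) linarith+
qed

end
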